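(* Let $X$ be a compact metric space, $T\colon X\to X$ a homeomorphism and $\mu$ an ergodic $T$-invariant Borel probability measure. Let $A\colon X\to\mathbb{GL}^+(2,\mathbb{R})$ be continuous and assume the cocycle generated by $A$ over $T$ has dominated splitting. For $\theta\in\mathbb{R}$ let $A_\theta(x)=A(x)R_\theta$. Then there exists a non-empty open set $\mathcal{U}\subseteq\mathbb{R}$ such that for every $\theta\in\mathcal{U}$ the cocycle $A_\theta$ (over $T$) has dominated splitting, and the function $\mathcal{U}\ni\theta\mapsto\lambda^+(A_\theta)\in\mathbb{R}$ is real analytic and strictly concave.
   Context: $\mathbb{GL}^+(2,\mathbb{R})$ denotes the real $2\times 2$ matrices with positive determinant, and $R_\theta$ the rotation of $\mathbb{R}^2$ by angle $\theta$. For continuous $B\colon X\to\mathbb{GL}(2,\mathbb{R})$, the linear cocycle generated by $B$ over $T$ is $(x,v)\mapsto(Tx,B(x)v)$ on $X\times\mathbb{R}^2$, with iterates $B^n(x)=B(T^{n-1}x)\cdots B(Tx)B(x)$ for $n>0$, $B^0=\mathrm{Id}$, and $B^{-n}(x)=B(T^{-n}x)^{-1}\cdots B(T^{-1}x)^{-1}$. The upper Lyapunov exponent is $\lambda^+(B)=\lim_{n\to\infty}\frac1n\log\|B^n(x)\|$, which exists and is constant for $\mu$-a.e. $x$. The cocycle has dominated splitting if there is a continuous decomposition $\mathbb{R}^2=E(x)\oplus F(x)$ into one-dimensional subspaces with $B(x)E(x)=E(Tx)$, $B(x)F(x)=F(Tx)$ for all $x$, and an integer $l\ge1$ with $\|B^l(x)|_{E(x)}\|\cdot\|B^{-l}(T^lx)|_{F(T^lx)}\|<\tfrac12$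 for all $x\in X$. *)

theory Defs
  imports "HOL-Analysis.Analysis" "HOL-Probability.Probability"
begin

type_synonym mat2 = "real^2^2"

definition rot :: "real \<Rightarrow> mat2" where
  "rot \<theta> = vector [vector [cos \<theta>, - sin \<theta>], vector [sin \<theta>, cos \<theta>]]"

fun cocycle :: "('a \<Rightarrow> mat2) \<Rightarrow> ('a \<Rightarrow> 'a) \<Rightarrow> nat \<Rightarrow> 'a \<Rightarrow> mat2" where
  "cocycle B T 0 x = mat 1"
| "cocycle B T (Suc n) x = B ((T ^^ n) x) ** cocycle B T n x"

fun cocycle_neg :: "('a \<Rightarrow> mat2) \<Rightarrow> ('a \<Rightarrow> 'a) \<Rightarrow> nat \<Rightarrow> 'a \<Rightarrow> mat2" where
  "cocycle_neg B T 0 x = mat 1"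
| "cocycle_neg B T (Suc n) x = matrix_inv (B ((inv T ^^ Suc n) x)) ** cocycle_neg B T n x"

definition norm_restr :: "(real^2) set \<Rightarrow> mat2 \<Rightarrow> real" where
  "norm_restr E M = Sup {norm (M *v v) | v. v \<in> E \<and> norm v = 1}"

definition continuous_line_field :: "('a::topological_space \<Rightarrow> (real^2) set) \<Rightarrow> bool" where
  "continuous_line_field E \<longleftrightarrow>
     (\<forall>x0. \<exists>U v. open U \<and> x0 \<in> U \<and> continuous_on U v \<and>
        (\<forall>y\<in>U. v y \<noteq> 0 \<and> E y = span {v y}))"

definition dominated_splitting :: "('a::topological_space \<Rightarrow> 'a) \<Rightarrow> ('a \<Rightarrow> mat2) \<Rightarrow> bool" where
  "dominated_splitting T B \<longleftrightarrow>
     (\<exists>E F. continuous_line_field E \<and> continuous_line_field F \<and>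
        (\<forall>x. E x \<inter> F x = {0}) \<and>
        (\<forall>x. (\<lambda>v. B x *v v) ` E x = E (T x)) \<and>
        (\<forall>x. (\<lambda>v. B x *v v) ` F x = F (T x)) \<and>
        (\<exists>l::nat. l \<ge> 1 \<and> (\<forall>x.
           norm_restr (E x) (cocycle B T l x) *
           norm_restr (F ((T ^^ l) x)) (cocycle_neg B T l ((T ^^ l) x)) < 1/2)))"

definition upper_lyapunov :: "'a measure \<Rightarrow> ('a \<Rightarrow> 'a) \<Rightarrow> ('a \<Rightarrow> mat2) \<Rightarrow> real" where
  "upper_lyapunov \<mu> T B =
     (THE L. AE x in \<mu>. (\<lambda>n. ln (onorm (\<lambda>v. cocycle B T n x *v v)) / real n) \<longlonglongrightarrow> L)"

definition ergodic :: "'a measure \<Rightarrow> ('a \<Rightarrow> 'a) \<Rightarrow> bool" where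
  "ergodic \<mu> T \<longleftrightarrow> (\<forall>A\<in>sets \<mu>. T -` A \<inter> space \<mu> = A \<longrightarrow>
      measure \<mu> A = 0 \<or> measure \<mu> A = 1)"

definition real_analytic_on :: "real set \<Rightarrow> (real \<Rightarrow> real) \<Rightarrow> bool" where
  "real_analytic_on U f \<longleftrightarrow>
     (\<forall>x\<in>U. \<exists>r>0. \<exists>c::nat \<Rightarrow> real. \<forall>y. \<bar>y - x\<bar> < r \<longrightarrow>
        (\<lambda>n. c n * (y - x) ^ n) sums f y)"

definition strictly_concave_on :: "real set \<Rightarrow> (real \<Rightarrow> real) \<Rightarrow> bool" where
  "strictly_concave_on S f \<longleftrightarrow> convex S \<and>
     (\<forall>x\<in>S. \<forall>y\<in>S. \<forall>t. x \<noteq> y \<and> 0 < t \<and> t < 1 \<longrightarrow>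
        f ((1 - t) * x + t * y) > (1 - t) * f x + t * f y)"

end

theory Submission
  imports Defs "HOL-Complex_Analysis.Complex_Analysis"
begin

text \<open>Let \<open>v x\<close> span the dominating line at angle \<open>0\<close>. In the moving frame \<open>(v, J v)\<close> the cocycle is
  upper triangular, and the invariant lines of \<open>A_\<theta>\<close> near \<open>\<theta> = 0\<close> are graphs: \<open>span (v + s J v)\<close> is the
  dominating line and \<open>span (p v + J v)\<close> the dominated one. Both slopes are fixed points of contracting
  graph transforms, the first over the inverse of \<open>T\<close>. That one also makes sense for complex \<open>\<theta>\<close>, so \<open>s\<close> is
  holomorphic in \<open>\<theta>\<close>. By Birkhoff's theorem the exponent is the integral of the logarithm of
  the growth along \<open>v + s J v\<close>, which gives analyticity.

  For concavity, evaluate the row vector annihilating the dominated line at \<open>\<theta>\<close> on the dominating line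
  at \<open>\<theta> + \<delta>\<close>. Up to coboundaries this yields
  \<open>\<lambda>(\<theta> + \<delta>) = \<lambda>(\<theta>) + \<integral> ln (cos \<delta> - c sin \<delta>)\<close> with \<open>c = (s' + p) / (1 - p s')\<close>, where \<open>p\<close> is taken at \<open>\<theta>\<close>
  and \<open>s'\<close> at \<open>\<theta> + \<delta>\<close>. As \<open>s\<close> is strictly increasing in the angle, replacing \<open>s'\<close> by \<open>s\<close> strictly
  increases the integral, and \<open>cos \<delta> - c sin \<delta> \<le> exp (- c \<delta>)\<close>. So \<open>\<lambda>\<close> has a strict supergradient at every
  \<open>\<theta>\<close>.\<close>

text \<open>In \<open>dominated_splitting\<close> the line F is the dominating one and E the
  dominated one. Domination is assumed only after \<open>l\<close> steps, while a graph transform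
  should contract at every step; the weight \<open>W\<close>, a change of the unit in which slopes
  are measured, repairs this. A second obstacle is that a line field need not have a continuous
  spanning vector: \<open>v\<close> comes from choice, and globally only expressions of degree 0 in
  \<open>v\<close> are used. The frame is orthogonal instead of being spanned by both invariant
  lines, so that rotations keep their usual matrix in it; the price is the off-diagonal coefficient
  \<open>b\<close>. Positive determinants make the projective action orientation preserving, hence
  slopes grow with the angle. Only the dominating slope enters the exponent, so the dominated slope
  is needed at real angles only. Strict concavity is not read off a second derivative: the
  comparison of two angles is an exact identity, and a pointwise strict inequality is
  integrated.\<close>

section \<open>Birkhoff's ergodic theorem\<close>

lemma integrable_comp_invariant:
  fixes f :: "'a \<Rightarrow> real"
  assumes "T \<in> measurable M M" "distr M M T = M" "integrable M f"
  shows "integrable M (\<lambda>x. f (T x))" "(\<integral>x. f (T x) \<partial>M) = (\<integral>x. f x \<partial>M)"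
proof -
  have "integrable (distr M M T) f" using assms by simp
  then show "integrable M (\<lambda>x. f (T x))" using assms(1) integrable_distr by blast
  have "f \<in> borel_measurable M" using assms(3) by auto
  then have "(\<integral>x. f x \<partial>(distr M M T)) = (\<integral>x. f (T x) \<partial>M)"
    by (rule integral_distr[OF assms(1)])
  then show "(\<integral>x. f (T x) \<partial>M) = (\<integral>x. f x \<partial>M)" using assms(2) by simp
qed

lemma birkhoff_sum_Suc:
  fixes g :: "'a \<Rightarrow> real"
  shows "(\<Sum>i<Suc n. g ((T ^^ i) x)) = g x + (\<Sum>i<n. g ((T ^^ i) (T x)))"
  by (subst sum.lessThan_Suc_shift) (simp add: funpow_swap1)

text \<open>The maxima \<open>mx n\<close> of the first Birkhoff sums satisfy \<open>mx (n + 1) = max 0 (g + mx n \<circ> T)\<close>.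
  If they were unbounded almost everywhere, then \<open>mx (n + 1) - mx n \<circ> T\<close>, whose integral is
  nonnegative, would converge to \<open>g\<close>.\<close>

lemma birkhoff_sums_bdd_above:
  fixes g :: "'a \<Rightarrow> real"
  assumes "prob_space M" and T: "T \<in> measurable M M" and inv: "distr M M T = M"
    and erg: "ergodic M T" and g: "g \<in> borel_measurable M" and gB: "\<And>x. \<bar>g x\<bar> \<le> B"
    and neg: "(\<integral>x. g x \<partial>M) < 0"
  shows "AE x in M. bdd_above (range (\<lambda>n. \<Sum>i<n. g ((T ^^ i) x)))"
proof -
  interpret prob_space M by fact
  define S where "S n x = (\<Sum>i<n. g ((T ^^ i) x))" for n x
  define mx where "mx n x = Max ((\<lambda>k. S k x) ` {..n})" for n x
  have S_Suc: "S (Suc n) x = g x + S n (T x)" for n x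
    unfolding S_def by (rule birkhoff_sum_Suc)
  have Tn: "(T ^^ i) \<in> measurable M M" for i
    using T by (induct i) (auto simp: funpow_swap1 intro: measurable_comp)
  have S_meas [measurable]: "S n \<in> borel_measurable M" for n
    unfolding S_def using measurable_compose[OF Tn g] by (intro borel_measurable_sum)
  have mx0: "mx 0 x = 0" for x by (simp add: mx_def S_def)
  have mx_ge: "S k x \<le> mx n x" if "k \<le> n" for k n x
    unfolding mx_def using that by (intro Max_ge) auto
  have mx_le: "mx n x \<le> c" if "\<And>k. k \<le> n \<Longrightarrow> S k x \<le> c" for n x c
    unfolding mx_def using that by (subst Max_le_iff) auto
  have mx_mem: "\<exists>k\<le>n. mx n x = S k x" for n x
  proof -
    have "mx n x \<in> (\<lambda>k. S k x) ` {..n}" unfolding mx_def by (intro Max_in) auto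
    then show ?thesis by auto
  qed
  have mx_nonneg: "0 \<le> mx n x" for n x
    using mx_ge[of 0 n x] by (simp add: S_def)
  have mx_mono: "mx n x \<le> mx (Suc n) x" for n x
    by (rule mx_le) (auto intro: mx_ge)
  have mx_Suc: "mx (Suc n) x = max 0 (g x + mx n (T x))" for n x
  proof (rule antisym)
    show "mx (Suc n) x \<le> max 0 (g x + mx n (T x))"
    proof (rule mx_le)
      fix k assume "k \<le> Suc n"
      then show "S k x \<le> max 0 (g x + mx n (T x))"
        using mx_ge[of "k - 1" n "T x"] by (cases k) (auto simp: S_Suc, auto simp: S_def)
    qed
    obtain k where "k \<le> n" "mx n (T x) = S k (T x)" using mx_mem by blast
    then have "g x + mx n (T x) \<le> mx (Suc n) x"
      using mx_ge[of "Suc k" "Suc n" x] by (simp add: S_Suc)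
    then show "max 0 (g x + mx n (T x)) \<le> mx (Suc n) x" using mx_nonneg by simp
  qed
  have mx_meas [measurable]: "mx n \<in> borel_measurable M" for n
    unfolding mx_def by (intro borel_measurable_Max) auto
  have B0: "0 \<le> B" using gB[of undefined] by linarith
  have mx_bd: "mx n x \<le> real n * B" for n x
  proof (induct n arbitrary: x)
    case 0 then show ?case by (simp add: mx0)
  next
    case (Suc n)
    have "g x \<le> B" using gB[of x] by linarith
    then show ?case using Suc[of "T x"] B0 by (auto simp: mx_Suc algebra_simps)
  qed
  have mx_int: "integrable M (mx n)" for n
    using mx_bd mx_nonneg B0 by (intro integrable_const_bound[where B = "real n * B"]) auto
  define Q where "Q = {x \<in> space M. bdd_above (range (\<lambda>n. S n x))}"
  \<comment> \<open>Natural numbers suffice as bounds, which presents \<open>Q\<close> through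
    countable unions and intersections and makes it measurable.\<close>
  have Q_eq: "Q = {x \<in> space M. \<exists>m::nat. \<forall>n. S n x \<le> real m}"
  proof -
    have "bdd_above (range (\<lambda>n. S n x)) \<longleftrightarrow> (\<exists>m::nat. \<forall>n. S n x \<le> real m)" for x
    proof
      assume "bdd_above (range (\<lambda>n. S n x))"
      then obtain c where "\<And>n. S n x \<le> c" by (auto simp: bdd_above_def)
      moreover obtain m :: nat where "c \<le> real m" using real_arch_simple by blast
      ultimately show "\<exists>m::nat. \<forall>n. S n x \<le> real m" using order_trans by blast
    qed (auto simp: bdd_above_def)
    then show ?thesis by (auto simp: Q_def)
  qed
  have Q_sets: "Q \<in> sets M" unfolding Q_eq by measurable
  \<comment> \<open>\<open>ergodic\<close> speaks of exactly invariant sets, so boundedness has to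
    be invariant at every point, not just almost everywhere.\<close>
  have bdd_T: "bdd_above (range (\<lambda>n. S n (T x))) \<longleftrightarrow> bdd_above (range (\<lambda>n. S n x))" for x
  proof
    assume "bdd_above (range (\<lambda>n. S n (T x)))"
    then obtain c where c: "\<And>n. S n (T x) \<le> c" by (auto simp: bdd_above_def)
    have "S n x \<le> max 0 (g x + c)" for n
      using c[of "n - 1"] by (cases n) (auto simp: S_Suc, auto simp: S_def)
    then show "bdd_above (range (\<lambda>n. S n x))" by (auto intro!: bdd_aboveI)
  next
    assume "bdd_above (range (\<lambda>n. S n x))"
    then obtain c where c: "\<And>n. S n x \<le> c" by (auto simp: bdd_above_def)
    have "S n (T x) \<le> c - g x" for n
      using c[of "Suc n"] by (auto simp: S_Suc)
    then show "bdd_above (range (\<lambda>n. S n (T x)))" by (auto intro!: bdd_aboveI)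
  qed
  have "T -` Q \<inter> space M = Q"
    using measurable_space[OF T] by (auto simp: Q_def bdd_T)
  then have "prob Q = 0 \<or> prob Q = 1" using erg Q_sets by (auto simp: ergodic_def)
  moreover have "prob Q \<noteq> 0"
  proof
    assume "prob Q = 0"
    then have nQ: "AE x in M. x \<notin> Q"
      using Q_sets by (intro AE_not_in) (simp add: null_sets_def emeasure_eq_measure)
    have TT: "AE x in M. T x \<notin> Q" using nQ
      by (rule AE_mp) (auto simp: Q_def bdd_T intro!: AE_I2)
    have lim: "AE x in M. (\<lambda>n. mx (Suc n) x - mx n (T x)) \<longlonglongrightarrow> g x"
      using TT AE_space
    proof eventually_elim
      fix x assume x: "T x \<notin> Q" "x \<in> space M"
      then have nb: "\<not> bdd_above (range (\<lambda>n. S n (T x)))"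
        using measurable_space[OF T] by (auto simp: Q_def)
      then obtain k where k: "- g x < S k (T x)"
        unfolding bdd_above_def by (auto simp: not_le)
      have "mx (Suc n) x - mx n (T x) = g x" if "k \<le> n" for n
        using mx_ge[OF that, of "T x"] k by (simp add: mx_Suc)
      then show "(\<lambda>n. mx (Suc n) x - mx n (T x)) \<longlonglongrightarrow> g x"
        by (intro tendsto_eventually eventually_sequentiallyI[of k]) auto
    qed
    have "(\<lambda>n. \<integral>x. mx (Suc n) x - mx n (T x) \<partial>M) \<longlonglongrightarrow> (\<integral>x. g x \<partial>M)"
    proof (rule integral_dominated_convergence[where w = "\<lambda>_. B"])
      \<comment> \<open>The difference is max (- mx n (T x)) (g x); as \<open>mx\<close> is
        nonnegative, its absolute value is at most that of \<open>g x\<close>.\<close>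
      show "AE x in M. norm (mx (Suc n) x - mx n (T x)) \<le> B" for n
      proof (rule AE_I2)
        fix x
        show "norm (mx (Suc n) x - mx n (T x)) \<le> B"
          using gB[of x] mx_nonneg[of n "T x"] by (auto simp: mx_Suc max_def)
      qed
      show "(\<lambda>x. mx (Suc n) x - mx n (T x)) \<in> borel_measurable M" for n
        using T by measurable
    qed (use g lim in auto)
    moreover have "0 \<le> (\<integral>x. mx (Suc n) x - mx n (T x) \<partial>M)" for n
    proof -
      have "(\<integral>x. mx (Suc n) x - mx n (T x) \<partial>M) = (\<integral>x. mx (Suc n) x \<partial>M) - (\<integral>x. mx n x \<partial>M)"
        using integrable_comp_invariant[OF T inv mx_int] mx_int by simp
      moreover have "(\<integral>x. mx n x \<partial>M) \<le> (\<integral>x. mx (Suc n) x \<partial>M)"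
        by (intro integral_mono mx_int mx_mono)
      ultimately show ?thesis by simp
    qed
    ultimately have "0 \<le> (\<integral>x. g x \<partial>M)" by (intro LIMSEQ_le_const) auto
    then show False using neg by simp
  qed
  ultimately have "prob Q = 1" by simp
  then have "AE x in M. x \<in> Q" using Q_sets prob_eq_1 by blast
  then show ?thesis by eventually_elim (auto simp: Q_def S_def)
qed

text \<open>The boundedness lemma is applied to +-(g - I) - e, whose integral is -e. If its sums
  stay below c, the averages of +-(g - I) stay below e + c / n, so the deviation has limsup at most
  \<open>e\<close> for both signs.\<close>

theorem birkhoff_ergodic_bounded:
  fixes g :: "'a \<Rightarrow> real"
  assumes "prob_space M" and T: "T \<in> measurable M M" and inv: "distr M M T = M"
    and erg: "ergodic M T" and g: "g \<in> borel_measurable M" and gB: "\<And>x. \<bar>g x\<bar> \<le> B"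
  shows "AE x in M. (\<lambda>n. (\<Sum>i<n. g ((T ^^ i) x)) / real n) \<longlonglongrightarrow> (\<integral>x. g x \<partial>M)"
proof -
  interpret prob_space M by fact
  define I where "I = (\<integral>x. g x \<partial>M)"
  have gi: "integrable M g"
    using g gB by (intro integrable_const_bound[where B = B]) auto
  have upper: "AE x in M. bdd_above (range (\<lambda>n. \<Sum>i<n. \<sigma> * (g ((T ^^ i) x) - I) - e))"
    if "e > 0" and "\<bar>\<sigma>\<bar> = 1" for e \<sigma> :: real
  proof (rule birkhoff_sums_bdd_above[where g = "\<lambda>x. \<sigma> * (g x - I) - e" and B = "B + \<bar>I\<bar> + e"])
    show "\<bar>\<sigma> * (g x - I) - e\<bar> \<le> B + \<bar>I\<bar> + e" for x
      using gB[of x] that by (auto simp: abs_if split: if_splits)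
    have "(\<integral>x. \<sigma> * (g x - I) - e \<partial>M) = \<sigma> * ((\<integral>x. g x \<partial>M) - I) - e"
      using gi by (simp add: prob_space)
    then show "(\<integral>x. \<sigma> * (g x - I) - e \<partial>M) < 0" using that by (simp add: I_def)
  qed (use assms in auto)
  \<comment> \<open>Only e = 1 / (m + 1) and two signs are used, so one null set is
    discarded.\<close>
  have "AE x in M. \<forall>m::nat. \<forall>\<sigma>\<in>{-1, 1}. bdd_above (range (\<lambda>n. \<Sum>i<n. \<sigma> * (g ((T ^^ i) x) - I) - 1 / real (Suc m)))"
    by (intro AE_all_countable[THEN iffD2] allI AE_finite_allI upper) auto
  then show ?thesis
  proof eventually_elim
    fix x assume x: "\<forall>m::nat. \<forall>\<sigma>\<in>{-1, 1}. bdd_above (range (\<lambda>n. \<Sum>i<n. \<sigma> * (g ((T ^^ i) x) - I) - 1 / real (Suc m)))"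
    have bound: "\<forall>\<^sub>F n in sequentially. \<sigma> * ((\<Sum>i<n. g ((T ^^ i) x)) / real n - I) < e"
      if e: "e > 0" and \<sigma>: "\<sigma> \<in> {-1, 1}" for e \<sigma> :: real
    proof -
      obtain m :: nat where "1 / real (Suc m) < e / 2"
        using e reals_Archimedean[of "e/2"] by (auto simp: inverse_eq_divide)
      moreover obtain c where c: "\<And>n. (\<Sum>i<n. \<sigma> * (g ((T ^^ i) x) - I) - 1 / real (Suc m)) \<le> c"
      proof -
        have "bdd_above (range (\<lambda>n. \<Sum>i<n. \<sigma> * (g ((T ^^ i) x) - I) - 1 / real (Suc m)))"
          by (rule bspec[OF spec[OF x] \<sigma>])
        then show ?thesis using that unfolding bdd_above_def by blast
      qed
      have "\<forall>\<^sub>F n in sequentially. c / real n < e / 2"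
        using e by (intro order_tendstoD(2)[OF lim_const_over_n[of c]]) simp
      then show ?thesis using eventually_gt_at_top[of 0]
      proof eventually_elim
        fix n :: nat assume n: "c / real n < e / 2" "0 < n"
        have eq: "\<sigma> * ((\<Sum>i<n. g ((T ^^ i) x)) / real n - I) - u
            = (\<sigma> * ((\<Sum>i<n. g ((T ^^ i) x)) - real n * I) - real n * u) / real n" for u
          using n(2) by (simp add: field_simps)
        have "\<sigma> * ((\<Sum>i<n. g ((T ^^ i) x)) - real n * I) - real n * (1 / real (Suc m)) \<le> c"
          using c[of n] by (simp add: sum_subtractf sum_distrib_left[symmetric] right_diff_distrib mult.left_commute)
        then have "\<sigma> * ((\<Sum>i<n. g ((T ^^ i) x)) / real n - I) - 1 / real (Suc m) \<le> c / real n"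
          unfolding eq using n(2) by (intro divide_right_mono) auto
        then show "\<sigma> * ((\<Sum>i<n. g ((T ^^ i) x)) / real n - I) < e"
          using n(1) \<open>1 / real (Suc m) < e / 2\<close> by linarith
      qed
    qed
    show "(\<lambda>n. (\<Sum>i<n. g ((T ^^ i) x)) / real n) \<longlonglongrightarrow> (\<integral>x. g x \<partial>M)"
      unfolding I_def[symmetric]
    proof (rule tendstoI)
      fix e :: real assume "e > 0"
      then have "\<forall>\<^sub>F n in sequentially. 1 * ((\<Sum>i<n. g ((T ^^ i) x)) / real n - I) < e"
        "\<forall>\<^sub>F n in sequentially. - 1 * ((\<Sum>i<n. g ((T ^^ i) x)) / real n - I) < e"
        using bound by blast+
      then show "\<forall>\<^sub>F n in sequentially. dist ((\<Sum>i<n. g ((T ^^ i) x)) / real n) I < e"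
        by eventually_elim (auto simp: dist_real_def)
    qed
  qed
qed

section \<open>Graph transforms and holomorphic parameters\<close>

text \<open>The value over \<open>x\<close> is computed from the value over \<open>S x\<close>.
  Pushing lines forward therefore takes the inverse of the dynamics as \<open>S\<close>, pulling
  them back takes the dynamics itself.\<close>

primrec graph_iter :: "('c \<Rightarrow> 'b \<Rightarrow> 'b) \<Rightarrow> ('c \<Rightarrow> 'c) \<Rightarrow> nat \<Rightarrow> 'c \<Rightarrow> 'b::banach" where
  "graph_iter G S 0 x = 0"
| "graph_iter G S (Suc n) x = G x (graph_iter G S n (S x))"

definition graph_lim :: "('c \<Rightarrow> 'b \<Rightarrow> 'b) \<Rightarrow> ('c \<Rightarrow> 'c) \<Rightarrow> 'c \<Rightarrow> 'b::banach" where
  "graph_lim G S x = lim (\<lambda>n. graph_iter G S n x)"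

text \<open>\<open>K x\<close> is the radius of the disc over \<open>x\<close>. \<open>lip\<close>
  is contraction by \<open>\<rho>\<close> when lengths over \<open>S x\<close> are measured in units
  of \<open>K (S x)\<close> and lengths over \<open>x\<close> in units of \<open>K x\<close>. With
  \<open>zero\<close> it maps discs into discs, since \<rho> K + (1 - \<rho>) K = K.
  \<open>cont\<close> speaks of sections inside the discs only, because outside them a denominator
  of \<open>G\<close> may vanish.\<close>

locale graph_transform =
  fixes G :: "'c::topological_space \<Rightarrow> 'b \<Rightarrow> 'b::banach" and S X K C \<rho>
  assumes S: "\<And>x. x \<in> X \<Longrightarrow> S x \<in> X"
    and K: "\<And>x. x \<in> X \<Longrightarrow> 0 < K x" "\<And>x. x \<in> X \<Longrightarrow> K x \<le> C"
    and \<rho>: "0 < \<rho>" "\<rho> < 1"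
    and zero: "\<And>x. x \<in> X \<Longrightarrow> norm (G x 0) \<le> (1 - \<rho>) * K x"
    and lip: "\<And>x s t. x \<in> X \<Longrightarrow> norm s \<le> K (S x) \<Longrightarrow> norm t \<le> K (S x) \<Longrightarrow>
      norm (G x s - G x t) * K (S x) \<le> \<rho> * norm (s - t) * K x"
    and cont: "\<And>f. continuous_on X f \<Longrightarrow> (\<And>x. x \<in> X \<Longrightarrow> norm (f x) \<le> K x) \<Longrightarrow>
      continuous_on X (\<lambda>x. G x (f (S x)))"
begin

text \<open>Consecutive iterates differ by at most \<rho>^n K x, because the first one lies within K
  x of the zero section. The telescoping series thus converges uniformly, and the Lipschitz bound
  carries the recursion over to the limit.\<close>

lemma graph_lim_props:
  shows "\<And>n x. x \<in> X \<Longrightarrow> norm (graph_iter G S n x) \<le> K x"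
    and "\<And>n. continuous_on X (graph_iter G S n)"
    and "uniform_limit X (graph_iter G S) (graph_lim G S) sequentially"
    and "continuous_on X (graph_lim G S)"
    and "\<And>x. x \<in> X \<Longrightarrow> norm (graph_lim G S x) \<le> K x"
    and "\<And>x. x \<in> X \<Longrightarrow> graph_lim G S x = G x (graph_lim G S (S x))"
proof -
  let ?g = "graph_iter G S"
  have lip': "norm (G x s - G x t) \<le> \<rho> * c * K x"
    if "x \<in> X" "norm s \<le> K (S x)" "norm t \<le> K (S x)" "norm (s - t) \<le> c * K (S x)" for x s t c
  proof -
    have "norm (G x s - G x t) * K (S x) \<le> \<rho> * norm (s - t) * K x" using lip that by blast
    also have "\<dots> \<le> \<rho> * (c * K (S x)) * K x"
      using that \<rho> K(1)[OF that(1)] by (intro mult_right_mono mult_left_mono) auto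
    finally have "norm (G x s - G x t) * K (S x) \<le> (\<rho> * c * K x) * K (S x)" by (simp add: mult_ac)
    then show ?thesis using K(1)[OF S[OF that(1)]] by simp
  qed
  show bd: "norm (?g n x) \<le> K x" if "x \<in> X" for n x
    using that
  proof (induct n arbitrary: x)
    case 0 then show ?case using K(1) by (simp add: less_imp_le)
  next
    case (Suc n)
    have i: "norm (?g n (S x)) \<le> K (S x)" using Suc S by blast
    have "norm (G x (?g n (S x)) - G x 0) \<le> \<rho> * 1 * K x"
      using i K(1)[OF S[OF Suc(2)]] Suc(2) by (intro lip') auto
    moreover have "norm (G x (?g n (S x))) \<le> norm (G x (?g n (S x)) - G x 0) + norm (G x 0)"
      by (metis diff_add_cancel norm_triangle_ineq)
    ultimately show ?case using zero[OF Suc(2)] by (simp add: algebra_simps)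
  qed
  show cn: "continuous_on X (?g n)" for n
  proof (induct n)
    case (Suc n) then show ?case using cont[OF Suc bd] by simp
  qed simp
  have step: "norm (?g (Suc n) x - ?g n x) \<le> \<rho> ^ n * K x" if "x \<in> X" for n x
    using that
  proof (induct n arbitrary: x)
    case 0
    then show ?case using bd[OF 0, of "Suc 0"] by simp
  next
    case (Suc n)
    show ?case using lip'[OF Suc(2) bd bd Suc(1)[OF S[OF Suc(2)]]] S[OF Suc(2)] by simp
  qed
  have "uniform_limit X (\<lambda>n x. \<Sum>i<n. ?g (Suc i) x - ?g i x) (\<lambda>x. \<Sum>i. ?g (Suc i) x - ?g i x) sequentially"
  proof (rule Weierstrass_m_test)
    show "norm (?g (Suc n) x - ?g n x) \<le> C * \<rho> ^ n" if "x \<in> X" for n x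
    proof -
      have "\<rho> ^ n * K x \<le> \<rho> ^ n * C" using K(2)[OF that] \<rho> by (intro mult_left_mono) auto
      then show ?thesis using step[OF that, of n] by (simp add: mult.commute)
    qed
    show "summable (\<lambda>n. C * \<rho> ^ n)" using \<rho> by (intro summable_mult summable_geometric) auto
  qed
  moreover have "(\<Sum>i<n. ?g (Suc i) x - ?g i x) = ?g n x" for n x
    by (subst sum_lessThan_telescope) simp
  ultimately have ul: "uniform_limit X ?g (\<lambda>x. \<Sum>i. ?g (Suc i) x - ?g i x) sequentially"
    by simp
  have eq: "graph_lim G S x = (\<Sum>i. ?g (Suc i) x - ?g i x)" if "x \<in> X" for x
    unfolding graph_lim_def using tendsto_uniform_limitI[OF ul that] by (rule limI)
  show UL: "uniform_limit X ?g (graph_lim G S) sequentially"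
    by (rule iffD2[OF uniform_limit_cong'[OF refl eq] ul])
  have lim: "(\<lambda>n. ?g n x) \<longlonglongrightarrow> graph_lim G S x" if "x \<in> X" for x
    using tendsto_uniform_limitI[OF UL that] .
  show "continuous_on X (graph_lim G S)"
    by (rule uniform_limit_theorem[OF _ UL]) (auto simp: cn)
  show bl: "norm (graph_lim G S x) \<le> K x" if "x \<in> X" for x
    using bd[OF that] by (intro LIMSEQ_le_const2[OF tendsto_norm[OF lim[OF that]]]) auto
  show "graph_lim G S x = G x (graph_lim G S (S x))" if x: "x \<in> X" for x
  proof (rule LIMSEQ_unique[OF LIMSEQ_Suc[OF lim[OF x]]])
    have p: "K (S x) > 0" using K(1) S x by blast
    have le: "norm (G x (?g n (S x)) - G x (graph_lim G S (S x)))
        \<le> \<rho> * (norm (?g n (S x) - graph_lim G S (S x)) / K (S x)) * K x" for n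
      using S[OF x] p by (intro lip' x bd bl) auto
    have "(\<lambda>n. \<rho> * (norm (?g n (S x) - graph_lim G S (S x)) / K (S x)) * K x) \<longlonglongrightarrow> 0"
    proof -
      have "(\<lambda>n. norm (?g n (S x) - graph_lim G S (S x))) \<longlonglongrightarrow> 0"
        using lim[OF S[OF x]] by (simp add: LIM_zero tendsto_norm_zero)
      then show ?thesis
        by (intro tendsto_mult_left_zero tendsto_mult_right_zero) (simp add: tendsto_divide_zero)
    qed
    from Lim_null_comparison[OF always_eventually[OF allI[OF le]] this]
    have "(\<lambda>n. G x (?g n (S x)) - G x (graph_lim G S (S x))) \<longlonglongrightarrow> 0" .
    then show "(\<lambda>n. ?g (Suc n) x) \<longlonglongrightarrow> G x (graph_lim G S (S x))"
      unfolding graph_iter.simps by (rule LIM_zero_cancel)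
  qed
qed

lemmas iter_bound = graph_lim_props(1)
  and lim_uniform = graph_lim_props(3) and lim_continuous = graph_lim_props(4)
  and lim_bound = graph_lim_props(5) and lim_invariant = graph_lim_props(6)

end

section \<open>Holomorphic dependence of integrals on a parameter\<close>

text \<open>Differentiation under the integral by dominated convergence: Cauchy's estimate turns the
  uniform bound on \<open>h\<close> into a bound on the difference quotients that is uniform in
  \<open>x\<close>.\<close>

lemma holomorphic_integral_parameter:
  fixes h :: "'a \<Rightarrow> complex \<Rightarrow> complex"
  assumes "prob_space M"
    and hol: "\<And>x. h x holomorphic_on ball 0 R"
    and bnd: "\<And>x z. z \<in> ball 0 R \<Longrightarrow> cmod (h x z) \<le> C"
    and meas: "\<And>z. z \<in> ball 0 R \<Longrightarrow> (\<lambda>x. h x z) \<in> borel_measurable M"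
  shows "(\<lambda>z. \<integral>x. h x z \<partial>M) holomorphic_on ball 0 R"
proof -
  interpret prob_space M by fact
  have int: "integrable M (\<lambda>x. h x z)" if "z \<in> ball 0 R" for z
    using bnd[OF that] meas[OF that] by (intro integrable_const_bound[where B = C]) auto
  have "\<exists>D. ((\<lambda>z. \<integral>x. h x z \<partial>M) has_field_derivative D) (at z)" if z: "z \<in> ball 0 R" for z
  proof -
    obtain e where e: "e > 0" "cball z e \<subseteq> ball 0 R"
      using open_contains_cball z by blast
    have deriv_lim: "((\<lambda>w. (h x w - h x z) / (w - z)) \<longlongrightarrow> deriv (h x) z) (at z)" for x
      using holomorphic_derivI[OF hol open_ball z] by (simp add: has_field_derivative_iff)
    \<comment> \<open>Points of the half-size ball carry a disc of radius e/2 inside the domain;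
      Cauchy's estimate on it gives C / (e/2).\<close>
    have quot: "cmod ((h x w - h x z) / (w - z)) \<le> 2 * C / e" if w: "w \<in> ball z (e/2)" "w \<noteq> z" for x w
    proof -
      have "cmod (deriv (h x) y) \<le> 2 * C / e" if y: "y \<in> ball z (e/2)" for y
      proof -
        have sub: "cball y (e/2) \<subseteq> ball 0 R"
        proof
          fix t assume "t \<in> cball y (e/2)"
          then have "dist z t \<le> e" using y dist_triangle[of z t y] by simp
          then show "t \<in> ball 0 R" using e by auto
        qed
        have "cmod ((deriv ^^ 1) (h x) y) \<le> fact 1 * C / (e/2) ^ 1"
        proof (rule Cauchy_inequality)
          show "h x holomorphic_on ball y (e / 2)"
            using hol sub ball_subset_cball holomorphic_on_subset by (metis subset_trans)
          show "continuous_on (cball y (e / 2)) (h x)"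
            using hol sub holomorphic_on_imp_continuous_on holomorphic_on_subset by blast
          show "cmod (h x w) \<le> C" if "cmod (y - w) = e / 2" for w
            using that sub by (intro bnd) (auto simp: dist_norm subset_iff)
        qed (use e in auto)
        then show ?thesis by (simp add: mult.commute)
      qed
      then have "cmod (h x w - h x z) \<le> 2 * C / e * cmod (w - z)"
      proof (intro field_differentiable_bound[where S = "ball z (e/2)"])
        fix y assume y: "y \<in> ball z (e/2)"
        then have "y \<in> cball z e" using e(1) by simp
        then have "y \<in> ball 0 R" using e(2) by blast
        then show "(h x has_field_derivative deriv (h x) y) (at y within ball z (e/2))"
          using holomorphic_derivI[OF hol open_ball] has_field_derivative_at_within by blast
      qed (use w e in auto)
      then show ?thesis using w by (simp add: norm_divide divide_le_eq)
    qed
    have "((\<lambda>w. ((\<integral>x. h x w \<partial>M) - (\<integral>x. h x z \<partial>M)) / (w - z)) \<longlongrightarrow> (\<integral>x. deriv (h x) z \<partial>M)) (at z)"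
      unfolding tendsto_at_iff_sequentially
    proof (intro allI impI)
      fix X :: "nat \<Rightarrow> complex" assume X: "\<forall>i. X i \<in> UNIV - {z}" "X \<longlonglongrightarrow> z"
      have "\<forall>\<^sub>F i in sequentially. X i \<in> ball z (e/2)"
        using X(2) e(1) by (metis centre_in_ball half_gt_zero open_ball topological_tendstoD)
      then obtain N where N: "\<And>i. i \<ge> N \<Longrightarrow> X i \<in> ball z (e/2)"
        by (auto simp: eventually_sequentially)
      \<comment> \<open>Dominated convergence wants the bound at every index, so the part of the
        sequence outside the small ball is dropped.\<close>
      define Y where "Y i = X (i + N)" for i
      have Y: "Y i \<in> ball z (e/2)" "Y i \<noteq> z" "Y i \<in> ball 0 R" for i
      proof -
        show y: "Y i \<in> ball z (e/2)" using N by (simp add: Y_def)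
        show "Y i \<noteq> z" using X(1) by (auto simp: Y_def)
        have "Y i \<in> cball z e" using y e(1) by simp
        then show "Y i \<in> ball 0 R" using e(2) by blast
      qed
      have Ylim: "Y \<longlonglongrightarrow> z" unfolding Y_def using X(2) by (rule LIMSEQ_ignore_initial_segment)
      have pt: "(\<lambda>i. (h x (Y i) - h x z) / (Y i - z)) \<longlonglongrightarrow> deriv (h x) z" for x
        using deriv_lim[of x] Y(2) Ylim unfolding tendsto_at_iff_sequentially by (auto simp: o_def)
      have ms: "(\<lambda>x. (h x (Y i) - h x z) / (Y i - z)) \<in> borel_measurable M" for i
        using meas[OF Y(3)] meas[OF z] by (intro borel_measurable_divide borel_measurable_diff) auto
      have "(\<lambda>i. \<integral>x. (h x (Y i) - h x z) / (Y i - z) \<partial>M) \<longlonglongrightarrow> (\<integral>x. deriv (h x) z \<partial>M)"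
        using quot[OF Y(1,2)] pt ms
        by (intro integral_dominated_convergence[where w = "\<lambda>_. 2 * C / e"]
            borel_measurable_LIMSEQ_metric[OF ms pt]) auto
      also have "(\<lambda>i. \<integral>x. (h x (Y i) - h x z) / (Y i - z) \<partial>M)
          = (\<lambda>i. ((\<integral>x. h x (Y i) \<partial>M) - (\<integral>x. h x z \<partial>M)) / (Y i - z))"
        using int[OF Y(3)] int[OF z] by simp
      finally have "(\<lambda>i. ((\<integral>x. h x (X (i + N)) \<partial>M) - (\<integral>x. h x z \<partial>M)) / (X (i + N) - z))
          \<longlonglongrightarrow> (\<integral>x. deriv (h x) z \<partial>M)" by (simp add: Y_def)
      then show "((\<lambda>w. ((\<integral>x. h x w \<partial>M) - (\<integral>x. h x z \<partial>M)) / (w - z)) \<circ> X)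
          \<longlonglongrightarrow> (\<integral>x. deriv (h x) z \<partial>M)"
        unfolding o_def by (rule LIMSEQ_offset)
    qed
    then show ?thesis by (auto simp: has_field_derivative_iff)
  qed
  then show ?thesis by (auto simp: holomorphic_on_open)
qed


text \<open>At a real centre the powers of y - x are real, so taking real parts of the complex
  Taylor coefficients commutes with the series.\<close>

lemma real_analytic_on_Re_holomorphic:
  assumes F: "F holomorphic_on ball 0 R" and f: "\<And>t. \<bar>t\<bar> < R \<Longrightarrow> f t = Re (F (of_real t))"
  shows "real_analytic_on {-R<..<R} f"
  unfolding real_analytic_on_def
proof
  fix x :: real assume "x \<in> {-R<..<R}"
  then have x: "\<bar>x\<bar> < R" by auto
  define e where "e = R - \<bar>x\<bar>"
  have sub: "ball (of_real x :: complex) e \<subseteq> ball 0 R"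
  proof
    fix t :: complex assume "t \<in> ball (of_real x) e"
    then have "cmod (t - of_real x) < e" by (simp add: dist_norm norm_minus_commute)
    moreover have "cmod t \<le> cmod (t - of_real x) + \<bar>x\<bar>"
      using norm_triangle_ineq[of "t - of_real x" "of_real x"] by simp
    ultimately show "t \<in> ball 0 R" by (simp add: e_def)
  qed
  define a where "a n = (deriv ^^ n) F (of_real x) / fact n" for n
  let ?c = "\<lambda>n. Re (a n)"
  have "(\<lambda>n. ?c n * (y - x) ^ n) sums f y" if y: "\<bar>y - x\<bar> < e" for y
  proof -
    have "complex_of_real y \<in> ball (of_real x) e"
      using y by (simp add: dist_norm norm_minus_commute flip: of_real_diff)
    then have "(\<lambda>n. a n * (of_real y - of_real x) ^ n) sums F (of_real y)"
      unfolding a_def using F sub holomorphic_on_subset holomorphic_power_series by blast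
    then have "(\<lambda>n. Re (a n * (of_real y - of_real x) ^ n)) sums Re (F (of_real y))"
      by (rule sums_Re)
    moreover have "Re (a n * (of_real y - of_real x) ^ n) = ?c n * (y - x) ^ n" for n
      by (simp flip: of_real_diff of_real_power)
    moreover have "f y = Re (F (of_real y))" using y by (intro f) (auto simp: e_def)
    ultimately show ?thesis by simp
  qed
  then show "\<exists>r>0. \<exists>c. \<forall>y. \<bar>y - x\<bar> < r \<longrightarrow> (\<lambda>n. c n * (y - x) ^ n) sums f y"
    using x by (intro exI[of _ e] conjI exI[of _ ?c]) (auto simp: e_def)
qed

section \<open>Rotating a triangular cocycle\<close>

text \<open>This is the projective action of the rotation followed by the matrix with rows (1,
  \<beta>) and (0, \<delta>). A difference of Moebius values is the determinant times s - t over the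
  product of the denominators, and the rotation has determinant 1.\<close>

lemma moebius_diff:
  fixes D1 :: "'b::{real_normed_field,banach}"
  assumes "D1 = cos \<theta> - s * sin \<theta> + \<beta> * (sin \<theta> + s * cos \<theta>)"
    "D2 = cos \<theta> - t * sin \<theta> + \<beta> * (sin \<theta> + t * cos \<theta>)" "D1 \<noteq> 0" "D2 \<noteq> 0"
  shows "\<delta> * (sin \<theta> + s * cos \<theta>) / D1 - \<delta> * (sin \<theta> + t * cos \<theta>) / D2 = \<delta> * (s - t) / (D1 * D2)"
proof -
  have "(sin \<theta> + s * cos \<theta>) * D2 - (sin \<theta> + t * cos \<theta>) * D1
      = (s - t) * ((sin \<theta>)\<^sup>2 + (cos \<theta>)\<^sup>2)"
    unfolding assms(1,2) by (simp only: power2_eq_square) algebra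
  then have "(sin \<theta> + s * cos \<theta>) * D2 - (sin \<theta> + t * cos \<theta>) * D1 = s - t" by simp
  then have "\<delta> * ((sin \<theta> + s * cos \<theta>) * D2 - (sin \<theta> + t * cos \<theta>) * D1) = \<delta> * (s - t)" by simp
  then show ?thesis using assms(3,4) by (simp add: field_simps)
qed

text \<open>The product exp(c \<delta>) (cos \<delta> - c sin \<delta>) is 1 at \<delta> = 0 and has
  derivative -(1 + c^2) exp(c \<delta>) sin \<delta>. Negative \<delta> reduces to positive \<delta>
  by changing the signs of both c and \<delta>.\<close>

lemma cos_minus_sin_le_exp:
  fixes c \<delta> :: real
  assumes "\<bar>\<delta>\<bar> \<le> pi"
  shows "cos \<delta> - c * sin \<delta> \<le> exp (- c * \<delta>)"
proof -
  have *: "exp (c * \<delta>) * (cos \<delta> - c * sin \<delta>) \<le> 1" if "0 \<le> \<delta>" "\<delta> \<le> pi" for c \<delta> :: real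
  proof -
    have "exp (c * \<delta>) * (cos \<delta> - c * sin \<delta>) \<le> exp (c * 0) * (cos 0 - c * sin 0)"
    proof (rule DERIV_nonpos_imp_nonincreasing[OF that(1)])
      fix x assume x: "0 \<le> x" "x \<le> \<delta>"
      have "((\<lambda>x. exp (c * x) * (cos x - c * sin x)) has_real_derivative
          (- ((1 + c\<^sup>2) * exp (c * x) * sin x))) (at x)"
        by (auto intro!: derivative_eq_intros simp: algebra_simps power2_eq_square)
      moreover have "0 \<le> (1 + c\<^sup>2) * exp (c * x) * sin x"
        using x that by (intro mult_nonneg_nonneg sin_ge_zero) auto
      ultimately show "\<exists>y. ((\<lambda>x. exp (c * x) * (cos x - c * sin x)) has_real_derivative y) (at x) \<and> y \<le> 0"
        by (intro exI conjI) auto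
    qed
    then show ?thesis by simp
  qed
  have "exp (c * \<delta>) * (cos \<delta> - c * sin \<delta>) \<le> 1"
    using *[of \<delta> c] *[of "- \<delta>" "- c"] assms by (cases "0 \<le> \<delta>") auto
  then have "exp (- (c * \<delta>)) * (exp (c * \<delta>) * (cos \<delta> - c * sin \<delta>)) \<le> exp (- (c * \<delta>)) * 1"
    by (intro mult_left_mono) auto
  then show ?thesis by (simp add: mult.assoc[symmetric] flip: exp_add)
qed

lemma integrable_continuous_compact:
  fixes f :: "'a::topological_space \<Rightarrow> real"
  assumes cpt: "compact (UNIV :: 'a set)" and "prob_space M" and sM: "sets M = sets borel"
    and f: "continuous_on UNIV f"
  shows "integrable M f"
proof -
  interpret prob_space M by fact
  obtain C where "\<And>x. norm (f x) \<le> C"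
    using compact_imp_bounded[OF compact_continuous_image[OF f cpt]] by (auto simp: bounded_iff)
  moreover have "f \<in> borel_measurable M"
    using borel_measurable_continuous_onI[OF f] measurable_cong_sets[OF sM refl] by blast
  ultimately show ?thesis by (intro integrable_const_bound[where B = C]) auto
qed

text \<open>Dominating slopes live in discs of radius \<open>r / W x\<close>, dominated slopes in
  intervals of radius \<open>R * W x\<close>. Near angle 0 the first are multiplied by about
  \<open>d x\<close> going forward, differences of the second by about \<open>d x\<close> going
  backward, so opposite powers of \<open>W\<close> make \<open>contr\<close> serve both.
  Denominators stay within \<open>\<epsilon>\<close> of 1, and (1 - \<epsilon>)^2 in
  \<open>contr\<close> pays for the two denominators of a Moebius difference. \<open>rR\<close>
  keeps the lines transversal; \<open>rW\<close> makes dominating slopes smaller than 1, which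
  monotonicity in the angle uses.\<close>

locale triangular_cocycle =
  fixes T Ti :: "'a::metric_space \<Rightarrow> 'a" and b d W :: "'a \<Rightarrow> real"
    and \<rho> \<epsilon> R r r0 :: real
  assumes cpt: "compact (UNIV :: 'a set)"
    and T_Ti [simp]: "T (Ti x) = x" and Ti_T [simp]: "Ti (T x) = x"
    and cont_T: "continuous_on UNIV T" and cont_Ti: "continuous_on UNIV Ti"
    and cont_b: "continuous_on UNIV b" and cont_d: "continuous_on UNIV d"
    and cont_W: "continuous_on UNIV W"
    and d_pos: "0 < d x" and W_pos: "0 < W x"
    and \<rho>: "0 < \<rho>" "\<rho> < 1" and \<epsilon>: "0 < \<epsilon>" "\<epsilon> < 1"
    and R_pos: "0 < R" and r_pos: "0 < r" and r0_pos: "0 < r0" and r0_le: "r0 \<le> pi / 4"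
    and contr: "d x * W (T x) \<le> \<rho> * (1 - \<epsilon>)\<^sup>2 * W x"
    and den_F: "cmod \<theta> < r0 \<Longrightarrow> cmod s * W x \<le> r \<Longrightarrow>
      cmod (cos \<theta> - s * sin \<theta> + of_real (b x) * (sin \<theta> + s * cos \<theta>) - 1) \<le> \<epsilon>"
    and zero_F: "cmod \<theta> < r0 \<Longrightarrow> d x * cmod (sin \<theta>) * W (T x) \<le> (1 - \<rho>) * r * (1 - \<epsilon>)"
    and den_E: "\<bar>t\<bar> < r0 \<Longrightarrow> \<bar>u\<bar> \<le> R * W (T x) \<Longrightarrow>
      \<bar>cos t - sin t * (d x * u - b x) - 1\<bar> \<le> \<epsilon>"
    and zero_E: "\<bar>t\<bar> < r0 \<Longrightarrow> \<bar>sin t - cos t * b x\<bar> \<le> (1 - \<rho>) * (R * W x) * (1 - \<epsilon>)"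
    and rR: "r * R \<le> 1 / 2" and rW: "r < W x"
begin

text \<open>\<open>den\<close> and \<open>num\<close> are the coordinates, in the frame (A v, J A
  v), of the image of v + s J v under the rotated matrix. The polymorphic type lets the same formula
  serve real and complex angles.\<close>

definition den :: "'a \<Rightarrow> 'b::{real_normed_field,banach} \<Rightarrow> 'b \<Rightarrow> 'b" where
  "den x \<theta> s = cos \<theta> - s * sin \<theta> + of_real (b x) * (sin \<theta> + s * cos \<theta>)"

definition num :: "'a \<Rightarrow> 'b::{real_normed_field,banach} \<Rightarrow> 'b \<Rightarrow> 'b" where
  "num x \<theta> s = of_real (d x) * (sin \<theta> + s * cos \<theta>)"

lemma den_of_real: "den x (of_real t) (of_real s) = of_real (den x t s)"
  by (simp add: den_def flip: cos_of_real sin_of_real)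

lemma num_of_real: "num x (of_real t) (of_real s) = of_real (num x t s)"
  by (simp add: num_def flip: cos_of_real sin_of_real)

lemma den_near_1: "cmod \<theta> < r0 \<Longrightarrow> cmod s * W x \<le> r \<Longrightarrow> cmod (den x \<theta> s - 1) \<le> \<epsilon>"
  unfolding den_def by (rule den_F)

lemma cmod_den: "cmod \<theta> < r0 \<Longrightarrow> cmod s * W x \<le> r \<Longrightarrow> 1 - \<epsilon> \<le> cmod (den x \<theta> s)"
  using den_near_1[of \<theta> s x] norm_triangle_ineq2[of 1 "1 - den x \<theta> s"]
  by (simp add: norm_minus_commute)

lemma Re_den: "cmod \<theta> < r0 \<Longrightarrow> cmod s * W x \<le> r \<Longrightarrow> 0 < Re (den x \<theta> s)"
  using den_near_1[of \<theta> s x] abs_Re_le_cmod[of "den x \<theta> s - 1"] \<epsilon> by simp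

text \<open>Difference quotients of both graph transforms have the form d / (D1 * D2), so this is
  the contraction estimate for both.\<close>

lemma contr_div:
  fixes D1 D2 :: real
  assumes "1 - \<epsilon> \<le> D1" "1 - \<epsilon> \<le> D2"
  shows "d x / (D1 * D2) * W (T x) \<le> \<rho> * W x"
proof -
  have "(1 - \<epsilon>)\<^sup>2 \<le> D1 * D2"
    using assms \<epsilon> by (simp add: power2_eq_square mult_mono)
  moreover have "0 < (1 - \<epsilon>)\<^sup>2" using \<epsilon> by simp
  ultimately have pos: "0 < D1 * D2" by linarith
  have "\<rho> * (1 - \<epsilon>)\<^sup>2 * W x \<le> \<rho> * (D1 * D2) * W x"
    using \<open>(1 - \<epsilon>)\<^sup>2 \<le> D1 * D2\<close> \<rho> W_pos[of x] by (intro mult_right_mono mult_left_mono) auto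
  then show ?thesis using contr[of x] pos by (simp add: divide_le_eq mult_ac)
qed

section \<open>The dominating slope at complex angles\<close>

text \<open>The angle is made part of the base point and left fixed by \<open>S_F\<close>. One
  instance of the locale then treats all angles at once and yields joint continuity and convergence
  uniform in the angle.\<close>

definition G_F :: "'a \<times> complex \<Rightarrow> complex \<Rightarrow> complex" where
  "G_F = (\<lambda>(y, \<theta>) s. num (Ti y) \<theta> s / den (Ti y) \<theta> s)"

definition S_F :: "'a \<times> complex \<Rightarrow> 'a \<times> complex" where
  "S_F = (\<lambda>(y, \<theta>). (Ti y, \<theta>))"

definition K_F :: "'a \<times> complex \<Rightarrow> real" where "K_F = (\<lambda>(y, \<theta>). r / W y)"

abbreviation "X_F \<equiv> (UNIV :: 'a set) \<times> ball (0::complex) r0"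

sublocale graph_F: graph_transform G_F S_F X_F K_F 1 \<rho>
proof
  show S: "S_F x \<in> X_F" if "x \<in> X_F" for x using that by (auto simp: S_F_def)
  show "0 < K_F x" if "x \<in> X_F" for x using r_pos W_pos by (auto simp: K_F_def split: prod.splits)
  show "K_F x \<le> 1" if "x \<in> X_F" for x
    using rW W_pos by (auto simp: K_F_def divide_le_eq less_imp_le split: prod.splits)
  show "0 < \<rho>" "\<rho> < 1" using \<rho> by auto
  show "norm (G_F x 0) \<le> (1 - \<rho>) * K_F x" if xX: "x \<in> X_F" for x
  proof -
    obtain y \<theta> where x: "x = (y, \<theta>)" "cmod \<theta> < r0" using xX by auto
    define D where "D = den (Ti y) \<theta> 0"
    have D: "1 - \<epsilon> \<le> cmod D" unfolding D_def using x r_pos by (intro cmod_den) auto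
    have "d (Ti y) * cmod (sin \<theta>) * W y \<le> (1 - \<rho>) * r * (1 - \<epsilon>)" using zero_F[OF x(2), of "Ti y"] by simp
    also have "\<dots> \<le> (1 - \<rho>) * r * cmod D" using D \<rho> r_pos by (intro mult_left_mono) auto
    finally have "d (Ti y) * cmod (sin \<theta>) * W y \<le> (1 - \<rho>) * r * cmod D" .
    moreover have "cmod D > 0" using D \<epsilon> by linarith
    ultimately have "d (Ti y) * cmod (sin \<theta>) / cmod D \<le> (1 - \<rho>) * (r / W y)"
      using W_pos[of y] by (simp add: field_simps)
    then show ?thesis
      using d_pos[of "Ti y"] by (simp add: G_F_def K_F_def x num_def norm_divide norm_mult D_def)
  qed
  show "norm (G_F x s - G_F x t) * K_F (S_F x) \<le> \<rho> * norm (s - t) * K_F x"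
    if xX: "x \<in> X_F" and that: "norm s \<le> K_F (S_F x)" "norm t \<le> K_F (S_F x)" for x s t
  proof -
    obtain y \<theta> where x: "x = (y, \<theta>)" "cmod \<theta> < r0" using xX by auto
    define z where "z = Ti y"
    have Tz: "T z = y" by (simp add: z_def)
    have st: "cmod s * W z \<le> r" "cmod t * W z \<le> r"
      using that W_pos[of z] by (auto simp: K_F_def S_F_def x z_def field_simps)
    define D1 where "D1 = den z \<theta> s"
    define D2 where "D2 = den z \<theta> t"
    have D: "1 - \<epsilon> \<le> cmod D1" "1 - \<epsilon> \<le> cmod D2"
      unfolding D1_def D2_def using x st by (auto intro: cmod_den)
    then have D0: "D1 \<noteq> 0" "D2 \<noteq> 0" using \<epsilon> by auto
    have "G_F x s - G_F x t = of_real (d z) * (s - t) / (D1 * D2)"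
      using moebius_diff[OF D1_def[unfolded den_def] D2_def[unfolded den_def] D0, of "of_real (d z)"]
      by (simp add: G_F_def x num_def flip: z_def D1_def D2_def)
    then have eq: "cmod (G_F x s - G_F x t) = d z / (cmod D1 * cmod D2) * cmod (s - t)"
      using d_pos[of z] by (simp add: norm_divide norm_mult)
    have "d z / (cmod D1 * cmod D2) * W y \<le> \<rho> * W z"
      using contr_div[OF D, of z] by (simp add: Tz)
    moreover have "k / W z \<le> \<rho> / W y" if "k * W y \<le> \<rho> * W z" for k
      using that W_pos[of z] W_pos[of y] by (simp add: divide_simps mult_ac)
    ultimately have "d z / (cmod D1 * cmod D2) / W z \<le> \<rho> / W y" by blast
    then have "d z / (cmod D1 * cmod D2) / W z * (cmod (s - t) * r) \<le> \<rho> / W y * (cmod (s - t) * r)"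
      using r_pos by (intro mult_right_mono) auto
    then show ?thesis by (simp add: K_F_def S_F_def x eq[unfolded x] flip: z_def)
  qed
  show "continuous_on X_F (\<lambda>x. G_F x (f (S_F x)))"
    if f: "continuous_on X_F f" and fK: "\<And>x. x \<in> X_F \<Longrightarrow> norm (f x) \<le> K_F x" for f
  proof -
    have cS: "continuous_on X_F S_F"
      unfolding S_F_def case_prod_unfold
      by (intro continuous_intros continuous_on_compose2[OF cont_Ti]) auto
    have cf: "continuous_on X_F (\<lambda>x. f (S_F x))"
      by (rule continuous_on_compose2[OF f cS]) (use S in blast)
    have cb: "continuous_on X_F (\<lambda>x. b (Ti (fst x)))" "continuous_on X_F (\<lambda>x. d (Ti (fst x)))"
      by (intro continuous_on_compose2[OF cont_b] continuous_on_compose2[OF cont_d]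
          continuous_on_compose2[OF cont_Ti] continuous_intros; simp)+
    have nz: "den (Ti (fst x)) (snd x) (f (S_F x)) \<noteq> 0" if "x \<in> X_F" for x
    proof -
      have "cmod (f (S_F x)) * W (Ti (fst x)) \<le> r"
        using fK[OF S[OF that]] W_pos[of "Ti (fst x)"]
        by (auto simp: K_F_def S_F_def field_simps split: prod.splits)
      then have "1 - \<epsilon> \<le> cmod (den (Ti (fst x)) (snd x) (f (S_F x)))"
        using that by (intro cmod_den) auto
      then show ?thesis using \<epsilon> by auto
    qed
    have "continuous_on X_F (\<lambda>x. num (Ti (fst x)) (snd x) (f (S_F x)) / den (Ti (fst x)) (snd x) (f (S_F x)))"
      by (rule continuous_on_divide) (use nz in \<open>auto simp: num_def den_def intro!: continuous_intros cb cf\<close>)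
    then show ?thesis by (simp add: G_F_def case_prod_unfold)
  qed
qed

definition sF :: "complex \<Rightarrow> 'a \<Rightarrow> complex" where "sF \<theta> x = graph_lim G_F S_F (x, \<theta>)"

lemma sF_bound: "cmod \<theta> < r0 \<Longrightarrow> cmod (sF \<theta> x) * W x \<le> r"
  using graph_F.lim_bound[of "(x, \<theta>)"] W_pos[of x] by (simp add: sF_def K_F_def field_simps)

lemma sF_iter_bound: "cmod \<theta> < r0 \<Longrightarrow> cmod (graph_iter G_F S_F n (x, \<theta>)) * W x \<le> r"
  using graph_F.iter_bound[of "(x, \<theta>)" n] W_pos[of x] by (simp add: K_F_def field_simps)

lemma sF_eq: "cmod \<theta> < r0 \<Longrightarrow> sF \<theta> (T x) = num x \<theta> (sF \<theta> x) / den x \<theta> (sF \<theta> x)"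
  unfolding sF_def by (subst graph_F.lim_invariant) (auto simp: G_F_def S_F_def)

lemma graph_iter_F_Suc:
  "graph_iter G_F S_F (Suc n) (x, \<theta>) = num (Ti x) \<theta> (graph_iter G_F S_F n (Ti x, \<theta>)) /
     den (Ti x) \<theta> (graph_iter G_F S_F n (Ti x, \<theta>))"
  by (simp add: G_F_def S_F_def)

lemma sF_lim: "cmod \<theta> < r0 \<Longrightarrow> (\<lambda>n. graph_iter G_F S_F n (x, \<theta>)) \<longlonglongrightarrow> sF \<theta> x"
  unfolding sF_def using graph_F.lim_uniform by (rule tendsto_uniform_limitI) auto

lemma continuous_sF: "cmod \<theta> < r0 \<Longrightarrow> continuous_on UNIV (sF \<theta>)"
  unfolding sF_def by (rule continuous_on_compose2[OF graph_F.lim_continuous]) (auto intro!: continuous_intros)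

text \<open>Each iterate is holomorphic because its denominators have positive real part; the
  uniform limit inherits this.\<close>

lemma holomorphic_sF: "(\<lambda>\<theta>. sF \<theta> x) holomorphic_on ball 0 r0"
proof (rule holomorphic_uniform_sequence[where f = "\<lambda>n \<theta>. graph_iter G_F S_F n (x, \<theta>)"])
  show "(\<lambda>\<theta>. graph_iter G_F S_F n (x, \<theta>)) holomorphic_on ball 0 r0" for n
  proof (induct n arbitrary: x)
    case (Suc n)
    have "den (Ti x) \<theta> (graph_iter G_F S_F n (Ti x, \<theta>)) \<noteq> 0" if "\<theta> \<in> ball 0 r0" for \<theta>
      using Re_den[OF _ sF_iter_bound, of \<theta> \<theta> "Ti x" n] that by auto
    then show ?case
      unfolding graph_iter_F_Suc
      by (intro holomorphic_on_divide) (auto simp: num_def den_def intro!: holomorphic_intros Suc)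
  qed simp
  show "\<exists>e>0. cball \<theta> e \<subseteq> ball 0 r0 \<and>
      uniform_limit (cball \<theta> e) (\<lambda>n \<theta>. graph_iter G_F S_F n (x, \<theta>)) (\<lambda>\<theta>. sF \<theta> x) sequentially"
    if \<theta>: "\<theta> \<in> ball 0 r0" for \<theta>
  proof -
    obtain e where e: "e > 0" "cball \<theta> e \<subseteq> ball 0 r0" using open_contains_cball \<theta> by blast
    have "uniform_limit (cball \<theta> e) (\<lambda>n \<theta>. graph_iter G_F S_F n (x, \<theta>)) (\<lambda>\<theta>. sF \<theta> x) sequentially"
      unfolding sF_def
    proof (rule uniform_limitI)
      fix c :: real assume "0 < c"
      from uniform_limitD[OF graph_F.lim_uniform this]
      show "\<forall>\<^sub>F n in sequentially. \<forall>z\<in>cball \<theta> e.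
          dist (graph_iter G_F S_F n (x, z)) (graph_lim G_F S_F (x, z)) < c"
        by eventually_elim (use e(2) in blast)
    qed
    with e show ?thesis by blast
  qed
qed auto

section \<open>The dominating slope at real angles and its monotonicity\<close>

definition s :: "real \<Rightarrow> 'a \<Rightarrow> real" where "s t x = Re (sF (of_real t) x)"

lemma graph_iter_F_real:
  "graph_iter G_F S_F n (x, of_real t) = of_real (Re (graph_iter G_F S_F n (x, of_real t)))"
proof (induct n arbitrary: x)
  case (Suc n)
  show ?case
    unfolding graph_iter_F_Suc by (subst (1 2 3 4) Suc) (simp add: num_of_real den_of_real)
qed simp

text \<open>The iterates start at 0 and have real coefficients at real angles, so the real part in
  \<open>s\<close> loses nothing.\<close>

lemma of_real_s:
  assumes "\<bar>t\<bar> < r0" shows "of_real (s t x) = sF (of_real t) x"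
proof (rule LIMSEQ_unique)
  have l: "(\<lambda>n. graph_iter G_F S_F n (x, of_real t)) \<longlonglongrightarrow> sF (of_real t) x"
    using assms by (intro sF_lim) simp
  then show "(\<lambda>n. graph_iter G_F S_F n (x, of_real t)) \<longlonglongrightarrow> sF (of_real t) x" .
  show "(\<lambda>n. graph_iter G_F S_F n (x, of_real t)) \<longlonglongrightarrow> of_real (s t x)"
    by (subst graph_iter_F_real) (use l in \<open>auto simp: s_def intro!: tendsto_intros\<close>)
qed

lemma s_bound: "\<bar>t\<bar> < r0 \<Longrightarrow> \<bar>s t x\<bar> * W x \<le> r"
  using sF_bound[of "of_real t" x] by (simp flip: of_real_s)

lemma continuous_s: "\<bar>t\<bar> < r0 \<Longrightarrow> continuous_on UNIV (s t)"
  unfolding s_def by (intro continuous_intros continuous_sF) auto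

lemma den_real: "\<bar>t\<bar> < r0 \<Longrightarrow> \<bar>u\<bar> * W x \<le> r \<Longrightarrow> \<bar>den x t u - 1\<bar> \<le> \<epsilon>"
  using den_near_1[of "of_real t" "of_real u" x]
  by (simp add: den_of_real flip: of_real_diff of_real_1[where 'a = complex] del: of_real_1)

lemma den_real_ge: "\<bar>t\<bar> < r0 \<Longrightarrow> \<bar>u\<bar> * W x \<le> r \<Longrightarrow> 1 - \<epsilon> \<le> den x t u"
  using den_real[of t u x] by linarith

lemma den_real_pos: "\<bar>t\<bar> < r0 \<Longrightarrow> \<bar>u\<bar> * W x \<le> r \<Longrightarrow> 0 < den x t u"
  using den_real_ge[of t u x] \<epsilon> by linarith

lemma s_eq:
  assumes "\<bar>t\<bar> < r0"
  shows "s t (T x) = num x t (s t x) / den x t (s t x)"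
proof -
  have "complex_of_real (s t (T x)) = of_real (num x t (s t x) / den x t (s t x))"
    using sF_eq[of "of_real t" x] assms by (simp add: num_of_real den_of_real flip: of_real_s)
  then show ?thesis using of_real_eq_iff by blast
qed

lemma abs_lt_1:
  assumes "\<bar>u\<bar> * W x \<le> r" shows "\<bar>u\<bar> < 1"
proof -
  have "\<bar>u\<bar> * W x < 1 * W x" using assms rW[of x] by simp
  then show ?thesis using W_pos[of x] by (simp only: mult_less_cancel_right_pos)
qed

text \<open>After cross-multiplication the terms with \<open>b\<close> cancel, and what remains is
  the cross product of the two rotated vectors, (u' - u) cos \<delta> + (1 + u u') sin \<delta>. It
  is strictly positive even for u = u'; d > 0 preserves the orientation.\<close>

lemma graph_map_mono:
  assumes t: "\<bar>t\<bar> < r0" "\<bar>t'\<bar> < r0" "t < t'" and u: "\<bar>u\<bar> * W x \<le> r" "\<bar>u'\<bar> * W x \<le> r" "u \<le> u'"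
  shows "num x t u / den x t u < num x t' u' / den x t' u'"
proof -
  define \<delta> where "\<delta> = t' - t"
  have \<delta>: "0 < \<delta>" "\<delta> < pi / 2" using t r0_le by (auto simp: \<delta>_def)
  have "\<bar>u * u'\<bar> < 1" using abs_mult_less[OF abs_lt_1[OF u(1)] abs_lt_1[OF u(2)]]
    by (simp add: abs_mult)
  then have "0 < (1 + u * u') * sin \<delta>" using \<delta> sin_gt_zero[of \<delta>] by (intro mult_pos_pos) auto
  moreover have "0 \<le> (u' - u) * cos \<delta>" using \<delta> cos_gt_zero[of \<delta>] u(3) by simp
  ultimately have pos: "0 < (u' - u) * cos \<delta> + (1 + u * u') * sin \<delta>" by linarith
  have D: "0 < den x t u" "0 < den x t' u'" using t u by (auto intro: den_real_pos)
  have "(sin t' + u' * cos t') * den x t u - (sin t + u * cos t) * den x t' u'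
      = (u' - u) * (cos t' * cos t + sin t' * sin t) + (1 + u * u') * (sin t' * cos t - cos t' * sin t)"
    by (simp add: den_def algebra_simps)
  also have "\<dots> = (u' - u) * cos \<delta> + (1 + u * u') * sin \<delta>"
    by (simp add: \<delta>_def sin_diff cos_diff)
  finally have "(sin t + u * cos t) * den x t' u' < (sin t' + u' * cos t') * den x t u"
    using pos by linarith
  then have "d x * ((sin t + u * cos t) * den x t' u') < d x * ((sin t' + u' * cos t') * den x t u)"
    using d_pos by simp
  then show ?thesis using D by (simp add: num_def divide_simps mult_ac)
qed

lemma s_strict_mono:
  assumes t: "\<bar>t\<bar> < r0" "\<bar>t'\<bar> < r0" "t < t'"
  shows "s t x < s t' x"
proof -
  let ?g = "\<lambda>n x t. Re (graph_iter G_F S_F n (x, of_real t))"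
  have b: "\<bar>?g n x t\<bar> * W x \<le> r" if "\<bar>t\<bar> < r0" for n x t
  proof -
    have "\<bar>?g n x t\<bar> * W x \<le> cmod (graph_iter G_F S_F n (x, of_real t)) * W x"
      by (intro mult_right_mono abs_Re_le_cmod less_imp_le[OF W_pos])
    also have "\<dots> \<le> r" using that by (intro sF_iter_bound) simp
    finally show ?thesis .
  qed
  have step: "?g (Suc n) x t = num (Ti x) t (?g n (Ti x) t) / den (Ti x) t (?g n (Ti x) t)" for n x t
    unfolding graph_iter_F_Suc by (subst (1 2) graph_iter_F_real) (simp add: num_of_real den_of_real)
  have "?g n x t \<le> ?g n x t'" for n x
  proof (induct n arbitrary: x)
    case (Suc n)
    show ?case unfolding step
      by (rule less_imp_le, rule graph_map_mono[OF t b[OF t(1)] b[OF t(2)] Suc])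
  qed simp
  moreover have "(\<lambda>n. ?g n x t) \<longlonglongrightarrow> s t x" if "\<bar>t\<bar> < r0" for t x
    unfolding s_def using that by (intro tendsto_Re sF_lim) simp
  ultimately have "s t x \<le> s t' x" for x
    using t by (intro LIMSEQ_le[of "\<lambda>n. ?g n x t" _ "\<lambda>n. ?g n x t'"]) auto
  \<comment> \<open>The limit of the iterates yields only a weak inequality; one more application of
    the graph map restores strictness.\<close>
  then have "s t (T (Ti x)) < s t' (T (Ti x))"
    unfolding s_eq[OF t(1)] s_eq[OF t(2)] by (intro graph_map_mono t s_bound)
  then show ?thesis by simp
qed

section \<open>The dominated slope\<close>

text \<open>Pull back the line of u A v + J A v and put m = d u - b. The inverse of the triangular
  map gives m v + J v up to a factor, and rotating by -t gives the coordinates sin t + cos t m and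
  cos t - sin t m. Their quotient is \<open>G_E\<close>, and \<open>denE\<close> is the second
  one.\<close>

definition denE :: "'a \<Rightarrow> real \<Rightarrow> real \<Rightarrow> real" where
  "denE x t u = cos t - sin t * (d x * u - b x)"

definition G_E :: "'a \<times> real \<Rightarrow> real \<Rightarrow> real" where
  "G_E = (\<lambda>(x, t) u. (sin t + cos t * (d x * u - b x)) / denE x t u)"

definition S_E :: "'a \<times> real \<Rightarrow> 'a \<times> real" where
  "S_E = (\<lambda>(x, t). (T x, t))"

definition K_E :: "'a \<times> real \<Rightarrow> real" where "K_E = (\<lambda>(x, t). R * W x)"

abbreviation "X_E \<equiv> (UNIV :: 'a set) \<times> {-r0<..<r0}"

lemma denE_ge: "\<bar>t\<bar> < r0 \<Longrightarrow> \<bar>u\<bar> \<le> R * W (T x) \<Longrightarrow> 1 - \<epsilon> \<le> denE x t u"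
  using den_E[of t u x] by (simp add: denE_def abs_le_iff)

lemma denE_pos: "\<bar>t\<bar> < r0 \<Longrightarrow> \<bar>u\<bar> \<le> R * W (T x) \<Longrightarrow> 0 < denE x t u"
  using denE_ge[of t u x] \<epsilon> by linarith

definition W_sup :: real where "W_sup = (SUP x. W x)"

lemma W_le: "W x \<le> W_sup"
proof -
  have "bdd_above (range W)"
    by (intro bounded_imp_bdd_above compact_imp_bounded compact_continuous_image cont_W cpt)
  then show ?thesis unfolding W_sup_def by (intro cSUP_upper) auto
qed

sublocale graph_E: graph_transform G_E S_E X_E K_E "R * W_sup" \<rho>
proof
  show S: "S_E x \<in> X_E" if "x \<in> X_E" for x using that by (auto simp: S_E_def)
  show "0 < K_E x" if "x \<in> X_E" for x using R_pos W_pos by (auto simp: K_E_def split: prod.splits)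
  show "K_E x \<le> R * W_sup" if "x \<in> X_E" for x
    using W_le R_pos by (auto simp: K_E_def split: prod.splits)
  show "0 < \<rho>" "\<rho> < 1" using \<rho> by auto
  show "norm (G_E x 0) \<le> (1 - \<rho>) * K_E x" if xX: "x \<in> X_E" for x
  proof -
    obtain y t where x: "x = (y, t)" "\<bar>t\<bar> < r0" using xX by auto
    define D where "D = denE y t 0"
    have D: "1 - \<epsilon> \<le> D" unfolding D_def using x R_pos W_pos[of "T y"] by (intro denE_ge) auto
    have "\<bar>sin t - cos t * b y\<bar> \<le> (1 - \<rho>) * (R * W y) * (1 - \<epsilon>)" using zero_E[OF x(2)] .
    also have "\<dots> \<le> (1 - \<rho>) * (R * W y) * D"
      using D \<rho> R_pos W_pos[of y] by (intro mult_left_mono) auto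
    finally have "\<bar>sin t - cos t * b y\<bar> / D \<le> (1 - \<rho>) * (R * W y)"
      using D \<epsilon> by (simp add: divide_le_eq)
    moreover have "D > 0" using D \<epsilon> by linarith
    ultimately show ?thesis by (simp add: G_E_def K_E_def x flip: D_def)
  qed
  show "norm (G_E x u - G_E x v) * K_E (S_E x) \<le> \<rho> * norm (u - v) * K_E x"
    if xX: "x \<in> X_E" and that: "norm u \<le> K_E (S_E x)" "norm v \<le> K_E (S_E x)" for x u v
  proof -
    obtain y t where x: "x = (y, t)" "\<bar>t\<bar> < r0" using xX by auto
    define D1 where "D1 = denE y t u"
    define D2 where "D2 = denE y t v"
    have D: "1 - \<epsilon> \<le> D1" "1 - \<epsilon> \<le> D2"
      unfolding D1_def D2_def using x that by (auto intro!: denE_ge simp: K_E_def S_E_def)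
    then have D0: "D1 > 0" "D2 > 0" using \<epsilon> by linarith+
    have "(sin t + cos t * (d y * u - b y)) * D2 - (sin t + cos t * (d y * v - b y)) * D1
        = d y * (u - v) * ((sin t)\<^sup>2 + (cos t)\<^sup>2)"
      unfolding D1_def D2_def denE_def by (simp only: power2_eq_square) algebra
    then have "(sin t + cos t * (d y * u - b y)) * D2 - (sin t + cos t * (d y * v - b y)) * D1
        = d y * (u - v)" by simp
    then have "G_E x u - G_E x v = d y * (u - v) / (D1 * D2)"
      using D0 by (simp add: G_E_def x diff_frac_eq mult_ac flip: D1_def D2_def)
    then have "\<bar>G_E x u - G_E x v\<bar> = d y / (D1 * D2) * \<bar>u - v\<bar>"
      using d_pos[of y] D0 by (simp add: abs_mult)
    moreover have "d y / (D1 * D2) * W (T y) * (\<bar>u - v\<bar> * R) \<le> \<rho> * W y * (\<bar>u - v\<bar> * R)"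
      using contr_div[OF D, of y] R_pos by (intro mult_right_mono) auto
    ultimately show ?thesis by (simp add: K_E_def S_E_def x mult_ac)
  qed
  show "continuous_on X_E (\<lambda>x. G_E x (f (S_E x)))"
    if f: "continuous_on X_E f" and fK: "\<And>x. x \<in> X_E \<Longrightarrow> norm (f x) \<le> K_E x" for f
  proof -
    have cS: "continuous_on X_E S_E"
      unfolding S_E_def case_prod_unfold
      by (intro continuous_intros continuous_on_compose2[OF cont_T]) auto
    have cf: "continuous_on X_E (\<lambda>x. f (S_E x))"
      by (rule continuous_on_compose2[OF f cS]) (use S in blast)
    have cb: "continuous_on X_E (\<lambda>x. b (fst x))" "continuous_on X_E (\<lambda>x. d (fst x))"
      by (intro continuous_on_compose2[OF cont_b] continuous_on_compose2[OF cont_d] continuous_intros; simp)+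
    have nz: "denE (fst x) (snd x) (f (S_E x)) \<noteq> 0" if "x \<in> X_E" for x
    proof -
      have "\<bar>f (S_E x)\<bar> \<le> R * W (T (fst x))"
        using fK[OF S[OF that]] by (auto simp: K_E_def S_E_def split: prod.splits)
      then have "0 < denE (fst x) (snd x) (f (S_E x))"
        using that by (intro denE_pos) auto
      then show ?thesis by simp
    qed
    have "continuous_on X_E (\<lambda>x. (sin (snd x) + cos (snd x) * (d (fst x) * f (S_E x) - b (fst x))) / denE (fst x) (snd x) (f (S_E x)))"
      by (rule continuous_on_divide) (use nz in \<open>auto simp: denE_def intro!: continuous_intros cb cf\<close>)
    then show ?thesis by (simp add: G_E_def case_prod_unfold)
  qed
qed

definition p :: "real \<Rightarrow> 'a \<Rightarrow> real" where "p t x = graph_lim G_E S_E (x, t)"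

lemma p_bound: "\<bar>t\<bar> < r0 \<Longrightarrow> \<bar>p t x\<bar> \<le> R * W x"
  using graph_E.lim_bound[of "(x, t)"] by (simp add: p_def K_E_def abs_less_iff)

lemma continuous_p: "\<bar>t\<bar> < r0 \<Longrightarrow> continuous_on UNIV (p t)"
  unfolding p_def by (rule continuous_on_compose2[OF graph_E.lim_continuous]) (auto intro!: continuous_intros)

lemma denE_p_ge: "\<bar>t\<bar> < r0 \<Longrightarrow> 1 - \<epsilon> \<le> denE x t (p t (T x))"
  by (intro denE_ge p_bound)

lemma denE_p_pos: "\<bar>t\<bar> < r0 \<Longrightarrow> 0 < denE x t (p t (T x))"
  by (intro denE_pos p_bound)

lemma p_eq:
  assumes "\<bar>t\<bar> < r0"
  shows "p t x * denE x t (p t (T x)) = sin t + cos t * (d x * p t (T x) - b x)"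
proof -
  have "p t x = (sin t + cos t * (d x * p t (T x) - b x)) / denE x t (p t (T x))"
    unfolding p_def by (subst graph_E.lim_invariant) (use assms in \<open>auto simp: G_E_def S_E_def\<close>)
  then show ?thesis using denE_p_pos[OF assms, of x] by (simp add: field_simps)
qed

section \<open>Comparing two angles\<close>

text \<open>The weights cancel between the two radii, leaving r R. Hence the dominated line at one
  angle is transversal to the dominating line at any other.\<close>

lemma ps_bound:
  assumes "\<bar>t\<bar> < r0" "\<bar>t'\<bar> < r0"
  shows "\<bar>p t x * s t' x\<bar> \<le> 1 / 2"
proof -
  have "\<bar>p t x * s t' x\<bar> \<le> R * W x * \<bar>s t' x\<bar>"
    using p_bound[OF assms(1), of x] by (simp add: abs_mult mult_right_mono)
  also have "\<dots> \<le> R * r" using s_bound[OF assms(2), of x] R_pos by (simp add: mult_ac)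
  finally show ?thesis using rR by (simp add: mult.commute)
qed

lemma den_s_ge: "\<bar>t\<bar> < r0 \<Longrightarrow> 1 - \<epsilon> \<le> den x t (s t x)"
  by (intro den_real_ge s_bound)

lemma den_s_pos: "\<bar>t\<bar> < r0 \<Longrightarrow> 0 < den x t (s t x)"
  by (intro den_real_pos s_bound)

lemma continuous_den_s: "\<bar>t\<bar> < r0 \<Longrightarrow> continuous_on UNIV (\<lambda>x. den x t (s t x))"
  unfolding den_def by (intro continuous_intros continuous_s cont_b) auto

text \<open>The row vector \<open>(1, - p)\<close> annihilating the dominated line at angle \<open>t\<close> is multiplied by
  \<open>denE\<close>; here it is evaluated on the dominating line at angle \<open>t'\<close>.\<close>

lemma den_cohomology:
  assumes t: "\<bar>t\<bar> < r0" "\<bar>t'\<bar> < r0"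
  shows "den x t' (s t' x) * (1 - p t (T x) * s t' (T x))
    = denE x t (p t (T x)) * ((1 - p t x * s t' x) * cos (t' - t) - (s t' x + p t x) * sin (t' - t))"
proof -
  define D where "D = den x t' (s t' x)"
  define m where "m = b x - d x * p t (T x)"
  have "s t' (T x) * D = d x * (sin t' + s t' x * cos t')"
    unfolding D_def using s_eq[OF t(2), of x] den_s_pos[OF t(2), of x] by (simp add: num_def)
  then have "D * (1 - p t (T x) * s t' (T x)) = D - p t (T x) * (d x * (sin t' + s t' x * cos t'))"
    by (metis mult.assoc mult.commute mult.right_neutral right_diff_distrib)
  also have "\<dots> = cos t' - s t' x * sin t' + m * (sin t' + s t' x * cos t')"
    by (simp add: D_def den_def m_def algebra_simps)
  \<comment> \<open>Expanding around t exposes the combinations cos t + sin t m and sin t - cos t m,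
    which are \<open>denE\<close> and p times \<open>denE\<close> by the invariance of
    \<open>p\<close>.\<close>
  also have "\<dots> = cos (t + (t' - t)) - s t' x * sin (t + (t' - t)) + m * (sin (t + (t' - t)) + s t' x * cos (t + (t' - t)))"
    by simp
  also have "\<dots> = (cos t + sin t * m - s t' x * (sin t - cos t * m)) * cos (t' - t)
      - (s t' x * (cos t + sin t * m) + (sin t - cos t * m)) * sin (t' - t)"
    unfolding sin_add cos_add by (simp add: algebra_simps)
  also have "cos t + sin t * m = denE x t (p t (T x))" by (simp add: m_def denE_def algebra_simps)
  also have "sin t - cos t * m = p t x * denE x t (p t (T x))"
    unfolding p_eq[OF t(1)] by (simp add: m_def algebra_simps)
  finally show ?thesis by (simp add: D_def algebra_simps)
qed

text \<open>By the addition formula this is tan (arctan s' + arctan p), the cotangent of the angle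
  from the dominating line at t' to the dominated line at t.\<close>

definition slope :: "real \<Rightarrow> real \<Rightarrow> 'a \<Rightarrow> real" where
  "slope t t' x = (s t' x + p t x) / (1 - p t x * s t' x)"

lemma one_minus_ps_pos: "\<bar>t\<bar> < r0 \<Longrightarrow> \<bar>t'\<bar> < r0 \<Longrightarrow> 0 < 1 - p t x * s t' x"
  using ps_bound[of t t' x] by (simp add: abs_le_iff)

text \<open>For fixed p the map from s to (s + p) / (1 - p s) is a Moebius map of determinant 1 +
  p^2.\<close>

lemma slope_strict_mono:
  assumes "\<bar>t\<bar> < r0" "\<bar>t1\<bar> < r0" "\<bar>t2\<bar> < r0" "t1 < t2"
  shows "slope t t1 x < slope t t2 x"
proof -
  have "(s t2 x + p t x) * (1 - p t x * s t1 x) - (s t1 x + p t x) * (1 - p t x * s t2 x)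
      = (s t2 x - s t1 x) * (1 + (p t x)\<^sup>2)"
    by (simp add: algebra_simps power2_eq_square)
  moreover have "0 < (s t2 x - s t1 x) * (1 + (p t x)\<^sup>2)"
    using s_strict_mono[OF assms(2-4), of x] by (intro mult_pos_pos) (auto intro: add_pos_nonneg)
  ultimately show ?thesis
    using one_minus_ps_pos[OF assms(1,2), of x] one_minus_ps_pos[OF assms(1,3), of x]
    unfolding slope_def by (subst frac_less_eq) (auto simp: mult_neg_pos mult_pos_pos intro: divide_neg_pos)
qed

text \<open>The logarithm of \<open>den_cohomology\<close>: the terms 1 - p s' form a coboundary.
  Positivity of the last factor follows from the identity itself, whose other factors are all
  positive.\<close>

lemma ln_den_decomp:
  assumes t: "\<bar>t\<bar> < r0" "\<bar>t'\<bar> < r0"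
  shows "0 < cos (t' - t) - slope t t' x * sin (t' - t)"
    and "ln (den x t' (s t' x)) = ln (denE x t (p t (T x))) + ln (1 - p t x * s t' x)
      - ln (1 - p t (T x) * s t' (T x)) + ln (cos (t' - t) - slope t t' x * sin (t' - t))"
proof -
  define k where "k = cos (t' - t) - slope t t' x * sin (t' - t)"
  have pos: "0 < 1 - p t y * s t' y" for y using one_minus_ps_pos[OF t] .
  have eq: "den x t' (s t' x) * (1 - p t (T x) * s t' (T x)) = denE x t (p t (T x)) * ((1 - p t x * s t' x) * k)"
    unfolding den_cohomology[OF t] k_def slope_def using pos[of x] by (simp add: field_simps)
  have "0 < den x t' (s t' x) * (1 - p t (T x) * s t' (T x))"
    using pos den_s_pos[OF t(2)] by simp
  then have k: "0 < k"
    unfolding eq using pos[of x] denE_p_pos[OF t(1), of x] by (simp add: zero_less_mult_iff)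
  then show "0 < cos (t' - t) - slope t t' x * sin (t' - t)" by (simp add: k_def)
  have "ln (den x t' (s t' x)) + ln (1 - p t (T x) * s t' (T x))
      = ln (denE x t (p t (T x))) + (ln (1 - p t x * s t' x) + ln k)"
    using pos[of x] pos[of "T x"] k denE_p_pos[OF t(1), of x] den_s_pos[OF t(2), of x] eq
    by (metis ln_mult_pos mult_pos_pos)
  then show "ln (den x t' (s t' x)) = ln (denE x t (p t (T x))) + ln (1 - p t x * s t' x)
      - ln (1 - p t (T x) * s t' (T x)) + ln (cos (t' - t) - slope t t' x * sin (t' - t))"
    by (simp add: k_def)
qed

text \<open>A strict supergradient is used at the convex combination of the two points; averaging
  its two inequalities cancels the linear terms.\<close>

lemma strictly_concave_exponent:
  assumes "prob_space M" and sM: "sets M = sets borel" and TM: "T \<in> measurable M M"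
    and inv: "distr M M T = M"
    and f: "\<And>t. \<bar>t\<bar> < r0 \<Longrightarrow> f t = c0 + (\<integral>x. ln (den x t (s t x)) \<partial>M)"
  shows "strictly_concave_on {-r0<..<r0} f"
proof -
  interpret prob_space M by fact
  let ?L = "\<lambda>t. \<integral>x. ln (den x t (s t x)) \<partial>M"
  note intg = integrable_continuous_compact[OF cpt assms(1,2)]
  have supergradient: "?L t' < ?L t + (t' - t) * (\<integral>x. - slope t t x \<partial>M)"
    if t: "\<bar>t\<bar> < r0" "\<bar>t'\<bar> < r0" "t \<noteq> t'" for t t'
  proof -
    define \<delta> where "\<delta> = t' - t"
    have \<delta>: "\<bar>\<delta>\<bar> < pi" "\<delta> \<noteq> 0" using t r0_le by (auto simp: \<delta>_def)
    \<comment> \<open>Subtracting the decompositions for (t, t') and (t, t) removes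
      \<open>denE\<close>; \<open>c\<close> is the resulting transfer function, and c - c o T
      integrates to 0.\<close>
    define c where "c x = ln (1 - p t x * s t' x) - ln (1 - p t x * s t x)" for x
    have less: "ln (den x t' (s t' x)) < ln (den x t (s t x)) + (c x - c (T x)) + \<delta> * (- slope t t x)" for x
    proof -
      \<comment> \<open>For negative \<delta> both the order of the slopes and the sign of the sine
        are reversed, so the inequality keeps its direction.\<close>
      have "cos \<delta> - slope t t' x * sin \<delta> < cos \<delta> - slope t t x * sin \<delta>"
      proof (cases "0 < \<delta>")
        case True
        then have "slope t t x < slope t t' x" "0 < sin \<delta>"
          using slope_strict_mono[OF t(1,1,2)] \<delta> sin_gt_zero by (auto simp: \<delta>_def)
        then show ?thesis by simp
      next
        case False
        then have "slope t t' x < slope t t x" "0 < sin (- \<delta>)"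
          using slope_strict_mono[OF t(1,2,1)] \<delta> sin_gt_zero[of "- \<delta>"] by (auto simp: \<delta>_def)
        then show ?thesis by simp
      qed
      also have "\<dots> \<le> exp (- slope t t x * \<delta>)" using \<delta> by (intro cos_minus_sin_le_exp) auto
      finally have "ln (cos \<delta> - slope t t' x * sin \<delta>) < - slope t t x * \<delta>"
        using ln_den_decomp(1)[OF t(1,2), of x] by (metis \<delta>_def exp_gt_zero ln_exp ln_less_cancel_iff)
      then show ?thesis
        using ln_den_decomp(2)[OF t(1,2), of x] ln_den_decomp(2)[OF t(1,1), of x]
        by (simp add: c_def \<delta>_def mult.commute)
    qed
    have nz: "1 - p t x * s t' x \<noteq> 0" "1 - p t x * s t x \<noteq> 0" "den x t (s t x) \<noteq> 0" "den x t' (s t' x) \<noteq> 0" for x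
      using one_minus_ps_pos[OF t(1,2), of x] one_minus_ps_pos[OF t(1,1), of x]
        den_s_pos[OF t(1), of x] den_s_pos[OF t(2), of x] by auto
    have ci: "integrable M c" unfolding c_def
      by (intro intg continuous_intros continuous_s continuous_p t) (use nz in auto)
    have L: "integrable M (\<lambda>x. ln (den x t (s t x)))" "integrable M (\<lambda>x. ln (den x t' (s t' x)))"
      by (intro intg continuous_on_ln continuous_den_s t; use nz in auto)+
    have sl: "integrable M (slope t t)" unfolding slope_def
      by (intro intg continuous_intros continuous_s continuous_p t) (use nz in auto)
    have "?L t' < (\<integral>x. ln (den x t (s t x)) + (c x - c (T x)) + \<delta> * (- slope t t x) \<partial>M)"
      using less L ci sl integrable_comp_invariant(1)[OF TM inv ci]
      by (intro integral_less_AE_space) (auto simp: emeasure_space_1)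
    also have "\<dots> = ?L t + \<delta> * (\<integral>x. - slope t t x \<partial>M)"
      using L ci sl integrable_comp_invariant[OF TM inv ci] by simp
    finally show ?thesis by (simp add: \<delta>_def)
  qed
  show ?thesis
    unfolding strictly_concave_on_def
  proof (intro conjI ballI allI impI)
    fix x y t assume xy: "x \<in> {-r0<..<r0}" "y \<in> {-r0<..<r0}" and t: "x \<noteq> y \<and> 0 < t \<and> (t::real) < 1"
    define z where "z = (1 - t) * x + t * y"
    define m where "m = (\<integral>x. - slope z z x \<partial>M)"
    have "z \<in> {-r0<..<r0}"
      unfolding z_def using xy t convexD[OF convex_real_interval(8), of x "-r0" r0 y "1 - t" t] by auto
    then have z: "\<bar>z\<bar> < r0" by auto
    have "z - x = t * (y - x)" "z - y = (1 - t) * (x - y)" by (simp_all add: z_def algebra_simps)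
    then have "z \<noteq> x" "z \<noteq> y" using t by auto
    then have "?L x < ?L z + (x - z) * m" "?L y < ?L z + (y - z) * m"
      unfolding m_def using supergradient[OF z] xy by auto
    then have "f x < f z + (x - z) * m" "f y < f z + (y - z) * m"
      using f[OF z] f[of x] f[of y] xy by auto
    then have "(1 - t) * f x < (1 - t) * (f z + (x - z) * m)" "t * f y < t * (f z + (y - z) * m)"
      using t by auto
    then have "(1 - t) * f x + t * f y < (1 - t) * (f z + (x - z) * m) + t * (f z + (y - z) * m)"
      by linarith
    also have "\<dots> = f z + ((1 - t) * x + t * y - z) * m" by (simp add: algebra_simps)
    also have "\<dots> = f z" by (simp add: z_def)
    finally show "(1 - t) * f x + t * f y < f ((1 - t) * x + t * y)" by (simp add: z_def)
  qed simp
qed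

text \<open>The principal logarithm needs no choice of branch, as \<open>den\<close> stays in a disc
  around 1 of radius \<epsilon> < 1.\<close>

lemma real_analytic_exponent:
  assumes "prob_space M" and sM: "sets M = sets borel"
    and f: "\<And>t. \<bar>t\<bar> < r0 \<Longrightarrow> f t = c + (\<integral>x. ln (den x t (s t x)) \<partial>M)"
  shows "real_analytic_on {-r0<..<r0} f"
proof (rule real_analytic_on_Re_holomorphic)
  interpret prob_space M by fact
  let ?h = "\<lambda>x \<theta>. Ln (den x \<theta> (sF \<theta> x))"
  have slit: "z \<notin> \<real>\<^sub>\<le>\<^sub>0" if "cmod (z - 1) \<le> \<epsilon>" for z :: complex
    using that abs_Re_le_cmod[of "z - 1"] \<epsilon> by (auto simp: complex_nonpos_Reals_iff)
  \<comment> \<open>Compactness of this disc gives the bound, uniform in point and angle, that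
    differentiation under the integral requires.\<close>
  have "continuous_on (cball (1::complex) \<epsilon>) Ln"
    using slit by (intro continuous_on_Ln continuous_on_id) (auto simp: dist_norm norm_minus_commute)
  then have "bounded (Ln ` cball (1::complex) \<epsilon>)"
    using compact_continuous_image compact_imp_bounded compact_cball by blast
  then obtain C where C: "\<And>z. cmod (z - 1) \<le> \<epsilon> \<Longrightarrow> cmod (Ln z) \<le> C"
    unfolding bounded_iff by (metis dist_norm image_eqI mem_cball norm_minus_commute)
  have near: "cmod (den x \<theta> (sF \<theta> x) - 1) \<le> \<epsilon>" if "\<theta> \<in> ball 0 r0" for x \<theta>
    using that by (intro den_near_1 sF_bound) auto
  have meas: "(\<lambda>x. ?h x \<theta>) \<in> borel_measurable M" if "\<theta> \<in> ball 0 r0" for \<theta>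
  proof -
    have "continuous_on UNIV (\<lambda>x. ?h x \<theta>)"
      using slit[OF near[OF that]] that unfolding den_def
      by (intro continuous_on_Ln continuous_intros continuous_sF cont_b) auto
    then show ?thesis
      using borel_measurable_continuous_onI measurable_cong_sets[OF sM refl] by blast
  qed
  have "(\<lambda>\<theta>. \<integral>x. ?h x \<theta> \<partial>M) holomorphic_on ball 0 r0"
  proof (rule holomorphic_integral_parameter[OF assms(1)])
    show "?h x holomorphic_on ball 0 r0" for x
    proof (rule holomorphic_on_Ln')
      show "(\<lambda>\<theta>. den x \<theta> (sF \<theta> x)) holomorphic_on ball 0 r0"
        unfolding den_def by (intro holomorphic_intros holomorphic_sF)
    qed (use slit[OF near] in auto)
  qed (use C near meas in auto)
  then show "(\<lambda>\<theta>. of_real c + (\<integral>x. ?h x \<theta> \<partial>M)) holomorphic_on ball 0 r0"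
    by (intro holomorphic_intros)
  fix t assume t: "\<bar>t\<bar> < r0"
  have "?h x (of_real t) = of_real (ln (den x t (s t x)))" for x
    using den_s_pos[OF t, of x] by (simp add: den_of_real Ln_of_real flip: of_real_s[OF t])
  then show "f t = Re (of_real c + (\<integral>x. ?h x (of_real t) \<partial>M))" using f[OF t] by simp
qed

end

section \<open>Choice of the constants and of the weight\<close>

text \<open>The order of choice matters: the rate and \<open>\<epsilon>\<close> first, then
  \<open>R\<close>, which has to absorb \<open>b\<close>, then \<open>r\<close> small relative to
  \<open>R\<close>, and last the range of angles, by continuity at 0.\<close>

lemma triangular_cocycle_exists:
  fixes T Ti :: "'a::metric_space \<Rightarrow> 'a" and b d W :: "'a \<Rightarrow> real"
  assumes cpt: "compact (UNIV :: 'a set)"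
    and inv: "\<And>x. T (Ti x) = x" "\<And>x. Ti (T x) = x"
    and cont: "continuous_on UNIV T" "continuous_on UNIV Ti"
      "continuous_on UNIV b" "continuous_on UNIV d" "continuous_on UNIV W"
    and pos: "\<And>x. 0 < d x" "\<And>x. 0 < W x"
    and q: "0 < q" "q < 1" and contr: "\<And>x. d x * W (T x) \<le> q * W x"
  shows "\<exists>\<rho> \<epsilon> R r r0. triangular_cocycle T Ti b d W \<rho> \<epsilon> R r r0"
proof -
  have bnd: "\<exists>B. \<forall>x. \<bar>f x\<bar> \<le> B" if "continuous_on UNIV f" for f :: "'a \<Rightarrow> real"
    using compact_imp_bounded[OF compact_continuous_image[OF that cpt]] by (auto simp: bounded_iff)
  obtain B1 B2 B3 where B: "\<And>x. \<bar>b x\<bar> \<le> B1" "\<And>x. \<bar>d x\<bar> \<le> B2" "\<And>x. \<bar>W x\<bar> \<le> B3"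
    using bnd[OF cont(3)] bnd[OF cont(4)] bnd[OF cont(5)] by blast
  define M where "M = Max {1, B1, B2, B3}"
  have M: "1 \<le> M" "\<bar>b x\<bar> \<le> M" "d x \<le> M" "W x \<le> M" for x
    using B(1)[of x] B(2)[of x] B(3)[of x] by (auto simp: M_def le_max_iff_disj)
  obtain x0 where x0: "\<And>x. W x0 \<le> W x"
    using continuous_attains_inf[OF cpt _ cont(5)] by auto
  define w where "w = W x0"
  have w: "0 < w" "\<And>x. w \<le> W x" using pos x0 by (auto simp: w_def)
  define \<rho> where "\<rho> = (1 + q) / 2"
  have \<rho>: "0 < \<rho>" "\<rho> < 1" "q < \<rho>" using q by (auto simp: \<rho>_def)
  \<comment> \<open>Solves \<rho> (1 - \<epsilon>)^2 = q, so that the hypothesis becomes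
    \<open>contr\<close>.\<close>
  define \<epsilon> where "\<epsilon> = 1 - sqrt (q / \<rho>)"
  have \<epsilon>: "0 < \<epsilon>" "\<epsilon> < 1" "\<rho> * (1 - \<epsilon>)\<^sup>2 = q" using q \<rho> by (auto simp: \<epsilon>_def)
  \<comment> \<open>Already at angle 0 the dominated transform sends 0 to - b x, which need not be
    small. This \<open>R\<close> makes (1 - \<rho>) R w (1 - \<epsilon>) equal to 1 + M, a bound
    valid at all angles.\<close>
  define R where "R = (1 + M) / ((1 - \<rho>) * w * (1 - \<epsilon>))"
  have R: "0 < R" using M(1) \<rho> w \<epsilon> by (simp add: R_def)
  \<comment> \<open>At angle 0 the quantity in \<open>den_F\<close> is b times the slope, so slopes
    up to \<open>\<eta>\<close> leave room below \<open>\<epsilon>\<close>.\<close>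
  define \<eta> where "\<eta> = min 1 (\<epsilon> / (4 * M))"
  have \<eta>: "0 < \<eta>" "\<eta> \<le> 1" "M * \<eta> < \<epsilon>"
  proof -
    show "0 < \<eta>" "\<eta> \<le> 1" using \<epsilon> M(1) by (auto simp: \<eta>_def)
    have "M * \<eta> \<le> M * (\<epsilon> / (4 * M))" using M(1) by (intro mult_left_mono) (auto simp: \<eta>_def)
    also have "\<dots> < \<epsilon>" using M(1) \<epsilon> by simp
    finally show "M * \<eta> < \<epsilon>" .
  qed
  define r where "r = min (\<eta> * w) (min (w / 2) (1 / (2 * R)))"
  have r: "0 < r" "r \<le> \<eta> * w" "r \<le> w / 2" "r \<le> 1 / (2 * R)" using \<eta> w R by (auto simp: r_def)
  \<comment> \<open>These three dominate the left sides of \<open>den_F\<close>,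
    \<open>zero_F\<close> and \<open>den_E\<close> uniformly in the point. Each satisfies its bound
    strictly at angle 0, hence on a small disc.\<close>
  define g1 where "g1 \<theta> = cmod (cos \<theta> - 1) + cmod (sin \<theta>) * (1 + M) + M * \<eta> * cmod (cos \<theta>)" for \<theta>
  define g2 where "g2 \<theta> = M * cmod (sin \<theta>) * M" for \<theta>
  define g3 where "g3 \<theta> = cmod (cos \<theta> - 1) + cmod (sin \<theta>) * (M * (R * M) + M)" for \<theta>
  have ev: "\<forall>\<^sub>F \<theta> in nhds 0. g \<theta> < c" if "continuous_on UNIV g" "g 0 < c" for g :: "complex \<Rightarrow> real" and c
  proof -
    have "(g \<longlongrightarrow> g 0) (nhds 0)"
      using that(1) by (metis UNIV_I continuous_on_eq_continuous_at isCont_def open_UNIV tendsto_at_iff_tendsto_nhds)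
    then show ?thesis using that(2) order_tendstoD(2) by blast
  qed
  have "\<forall>\<^sub>F \<theta> in nhds 0. g1 \<theta> < \<epsilon> \<and> g2 \<theta> < (1 - \<rho>) * r * (1 - \<epsilon>) \<and> g3 \<theta> < \<epsilon>"
    using \<eta> \<epsilon> \<rho> r unfolding g1_def g2_def g3_def
    by (intro eventually_conj ev continuous_intros) auto
  then obtain \<delta> where \<delta>: "\<delta> > 0"
    "\<And>\<theta>. cmod \<theta> < \<delta> \<Longrightarrow> g1 \<theta> < \<epsilon> \<and> g2 \<theta> < (1 - \<rho>) * r * (1 - \<epsilon>) \<and> g3 \<theta> < \<epsilon>"
    by (auto simp: eventually_nhds_metric dist_norm)
  define r0 where "r0 = min \<delta> (pi / 4)"
  have "triangular_cocycle T Ti b d W \<rho> \<epsilon> R r r0"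
  proof
    show "0 < r0" "r0 \<le> pi / 4" using \<delta>(1) by (auto simp: r0_def)
    show "d x * W (T x) \<le> \<rho> * (1 - \<epsilon>)\<^sup>2 * W x" for x using contr \<epsilon>(3) by simp
    show "cmod (cos \<theta> - \<sigma> * sin \<theta> + of_real (b x) * (sin \<theta> + \<sigma> * cos \<theta>) - 1) \<le> \<epsilon>"
      if "cmod \<theta> < r0" "cmod \<sigma> * W x \<le> r" for \<theta> \<sigma> x
    proof -
      have "cmod \<sigma> * w \<le> cmod \<sigma> * W x" using w by (intro mult_left_mono) auto
      then have "cmod \<sigma> * w \<le> \<eta> * w" using that r by linarith
      then have \<sigma>: "cmod \<sigma> \<le> \<eta>" using w(1) by simp
      have "cos \<theta> - \<sigma> * sin \<theta> + of_real (b x) * (sin \<theta> + \<sigma> * cos \<theta>) - 1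
          = (cos \<theta> - 1) + (sin \<theta> * (of_real (b x) - \<sigma>) + of_real (b x) * \<sigma> * cos \<theta>)"
        by (simp add: algebra_simps)
      also have "cmod \<dots> \<le> cmod (cos \<theta> - 1) + (cmod (sin \<theta>) * cmod (of_real (b x) - \<sigma>) + \<bar>b x\<bar> * cmod \<sigma> * cmod (cos \<theta>))"
      proof (intro norm_triangle_le add_left_mono)
        show "cmod (sin \<theta> * (of_real (b x) - \<sigma>)) + cmod (of_real (b x) * \<sigma> * cos \<theta>)
            \<le> cmod (sin \<theta>) * cmod (of_real (b x) - \<sigma>) + \<bar>b x\<bar> * cmod \<sigma> * cmod (cos \<theta>)"
          by (simp add: norm_mult)
      qed
      also have "\<dots> \<le> g1 \<theta>"
      proof -
        have "cmod (of_real (b x) - \<sigma>) \<le> 1 + M"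
          using norm_triangle_ineq4[of "of_real (b x)" \<sigma>] M(2)[of x] \<sigma> \<eta> by simp
        then have "cmod (sin \<theta>) * cmod (of_real (b x) - \<sigma>) \<le> cmod (sin \<theta>) * (1 + M)"
          by (intro mult_left_mono) auto
        moreover have "\<bar>b x\<bar> * cmod \<sigma> * cmod (cos \<theta>) \<le> M * \<eta> * cmod (cos \<theta>)"
          using M(1) M(2)[of x] \<sigma> by (intro mult_right_mono mult_mono) auto
        ultimately show ?thesis by (simp add: g1_def)
      qed
      also have "\<dots> \<le> \<epsilon>" using \<delta>(2)[of \<theta>] that by (simp add: r0_def)
      finally show ?thesis .
    qed
    show "d x * cmod (sin \<theta>) * W (T x) \<le> (1 - \<rho>) * r * (1 - \<epsilon>)" if "cmod \<theta> < r0" for \<theta> x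
    proof -
      have "d x * cmod (sin \<theta>) * W (T x) \<le> g2 \<theta>"
        unfolding g2_def using M less_imp_le[OF pos(1)] less_imp_le[OF pos(2)] by (intro mult_mono) auto
      then show ?thesis using \<delta>(2)[of \<theta>] that by (simp add: r0_def)
    qed
    show "\<bar>cos t - sin t * (d x * u - b x) - 1\<bar> \<le> \<epsilon>" if "\<bar>t\<bar> < r0" "\<bar>u\<bar> \<le> R * W (T x)" for t u x
    proof -
      have "\<bar>d x * u - b x\<bar> \<le> d x * \<bar>u\<bar> + \<bar>b x\<bar>"
        using abs_triangle_ineq4[of "d x * u" "b x"] pos(1)[of x] by (simp add: abs_mult)
      also have "\<dots> \<le> M * (R * M) + M"
      proof (intro add_mono mult_mono)
        have "R * W (T x) \<le> R * M" using R M(4) by simp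
        then show "\<bar>u\<bar> \<le> R * M" using that(2) by linarith
      qed (use M(1) M(2)[of x] M(3)[of x] in auto)
      finally have sb: "\<bar>sin t * (d x * u - b x)\<bar> \<le> \<bar>sin t\<bar> * (M * (R * M) + M)"
        by (simp add: abs_mult mult_left_mono)
      have "\<bar>cos t - sin t * (d x * u - b x) - 1\<bar> \<le> g3 (of_real t)"
      proof -
        have "cmod (cos (of_real t) - 1) = \<bar>cos t - 1\<bar>" "cmod (sin (of_real t)) = \<bar>sin t\<bar>"
          by (metis cos_of_real norm_of_real of_real_1 of_real_diff, metis sin_of_real norm_of_real)
        then have "g3 (of_real t) = \<bar>cos t - 1\<bar> + \<bar>sin t\<bar> * (M * (R * M) + M)" by (simp only: g3_def)
        then show ?thesis using sb by arith
      qed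
      then show ?thesis using \<delta>(2)[of "of_real t"] that by (simp add: r0_def)
    qed
    show "\<bar>sin t - cos t * b x\<bar> \<le> (1 - \<rho>) * (R * W x) * (1 - \<epsilon>)" for t x
    proof -
      have "\<bar>cos t * b x\<bar> \<le> 1 * M" unfolding abs_mult using M(2)[of x] by (intro mult_mono) auto
      then have "\<bar>sin t - cos t * b x\<bar> \<le> 1 + M" using abs_sin_le_one[of t] by linarith
      also have "\<dots> = (1 - \<rho>) * (R * w) * (1 - \<epsilon>)" using \<rho> w \<epsilon> by (simp add: R_def)
      also have "\<dots> \<le> (1 - \<rho>) * (R * W x) * (1 - \<epsilon>)"
        using \<rho> w \<epsilon> R by (intro mult_right_mono mult_left_mono) auto
      finally show ?thesis .
    qed
    show "r * R \<le> 1 / 2" using r(4) R by (simp add: field_simps)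
    show "r < W x" for x using r(3) w(1) w(2)[of x] by linarith
  qed (use assms \<rho> \<epsilon> R r in auto)
  then show ?thesis by blast
qed

text \<open>The classical adapted norm. Multiplying W o T by \<open>d\<close> shifts the sum by one
  index, so only end terms survive: d W o T = q (W + P_N / q^N - 1).\<close>

lemma adapted_weight:
  fixes T :: "'a::topological_space \<Rightarrow> 'a" and d :: "'a \<Rightarrow> real"
  assumes cont: "continuous_on UNIV T" "continuous_on UNIV d" and pos: "\<And>x. 0 < d x"
    and N: "0 < N" "\<And>x. (\<Prod>i<N. d ((T ^^ i) x)) \<le> 1 / 2"
  shows "\<exists>W q. continuous_on UNIV W \<and> (\<forall>x. 0 < W x) \<and> 0 < q \<and> q < (1::real) \<and>
    (\<forall>x. d x * W (T x) \<le> q * W x)"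
proof -
  \<comment> \<open>With q^N = 1 / 2 the surviving end term is nonpositive exactly by the N-step
    bound.\<close>
  define q where "q = root N (1 / 2)"
  have q: "0 < q" "q < 1" "q ^ N = 1 / 2" using N(1) by (auto simp: q_def)
  define P where "P k x = (\<Prod>i<k. d ((T ^^ i) x))" for k x
  define W where "W x = (\<Sum>k<N. P k x / q ^ k)" for x
  have Pp: "0 < P k x" for k x unfolding P_def using pos by (intro prod_pos) auto
  have PS: "d x * P k (T x) = P (Suc k) x" for k x
    unfolding P_def by (subst prod.lessThan_Suc_shift) (simp add: funpow_swap1)
  have Tk: "continuous_on UNIV (T ^^ i)" for i
    by (induct i) (auto intro: continuous_on_compose2[OF cont(1)] simp: o_def id_def)
  have "continuous_on UNIV W"
    unfolding W_def P_def using q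
    by (intro continuous_intros continuous_on_compose2[OF cont(2)] Tk) auto
  moreover have "0 < W x" for x
    unfolding W_def using Pp q N(1) by (intro sum_pos divide_pos_pos) auto
  moreover have "d x * W (T x) \<le> q * W x" for x
  proof -
    have "d x * W (T x) = (\<Sum>k<N. P (Suc k) x / q ^ k)"
      by (simp add: W_def sum_distrib_left PS)
    also have "\<dots> = q * (\<Sum>k<N. P (Suc k) x / q ^ Suc k)"
      using q by (simp add: sum_distrib_left)
    also have "(\<Sum>k<N. P (Suc k) x / q ^ Suc k) = (\<Sum>k<Suc N. P k x / q ^ k) - P 0 x / q ^ 0"
      by (subst sum.lessThan_Suc_shift) simp
    also have "\<dots> = W x + (P N x / q ^ N - 1)" by (simp add: W_def P_def)
    also have "P N x / q ^ N - 1 \<le> 0" using N(2)[of x] q by (simp add: P_def)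
    finally show ?thesis using q by simp
  qed
  ultimately show ?thesis using q by blast
qed

section \<open>Line fields in the plane\<close>

text \<open>The quarter turn. It commutes with rotations, so \<open>rot t\<close> has its usual
  matrix in every frame (w, J w).\<close>

definition J :: "real^2 \<Rightarrow> real^2" where "J v = vector [- v $ 2, v $ 1]"

lemma J_nth [simp]: "J v $ 1 = - v $ 2" "J v $ 2 = v $ 1"
  by (simp_all add: J_def)

lemma vec2_eq_iff: "(v :: real^2) = w \<longleftrightarrow> v $ 1 = w $ 1 \<and> v $ 2 = w $ 2"
  by (auto simp: vec_eq_iff forall_2)

lemma inner_vec2: "(v :: real^2) \<bullet> w = v $ 1 * w $ 1 + v $ 2 * w $ 2"
  by (simp add: inner_vec_def sum_2)

lemma mat2_mult_nth:
  "((M :: mat2) *v v) $ 1 = M $ 1 $ 1 * v $ 1 + M $ 1 $ 2 * v $ 2"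
  "(M *v v) $ 2 = M $ 2 $ 1 * v $ 1 + M $ 2 $ 2 * v $ 2"
  by (simp_all add: matrix_vector_mult_def sum_2)

lemma J_add: "J (v + w) = J v + J w" and J_scaleR: "J (c *\<^sub>R v) = c *\<^sub>R J v" and J_J: "J (J v) = - v"
  by (simp_all add: vec2_eq_iff)

lemma linear_J: "linear J"
  by (rule linearI) (simp_all add: J_add J_scaleR)

lemma rot_mult: "rot t *v v = cos t *\<^sub>R v + sin t *\<^sub>R J v"
  by (simp add: vec2_eq_iff mat2_mult_nth rot_def)

lemma continuous_on_J:
  assumes "continuous_on S f" shows "continuous_on S (\<lambda>x. J (f x))"
  using assms linear_J bounded_linear.continuous_on linear_conv_bounded_linear by blast

lemma norm_J_comb: "norm (a *\<^sub>R v + c *\<^sub>R J v) = sqrt (a\<^sup>2 + c\<^sup>2) * norm v"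
proof -
  have "(norm (a *\<^sub>R v + c *\<^sub>R J v))\<^sup>2 = (a\<^sup>2 + c\<^sup>2) * (norm v)\<^sup>2"
    unfolding power2_norm_eq_inner inner_vec2 by (simp add: algebra_simps power2_eq_square)
  then show ?thesis by (metis norm_ge_zero real_sqrt_mult real_sqrt_unique)
qed

lemma J_decomp: "w \<noteq> 0 \<Longrightarrow> z = ((z \<bullet> w) / (w \<bullet> w)) *\<^sub>R w + ((z \<bullet> J w) / (w \<bullet> w)) *\<^sub>R J w"
proof -
  assume "w \<noteq> 0"
  then have "w \<bullet> w \<noteq> 0" by simp
  moreover have "(w \<bullet> w) *\<^sub>R z = (z \<bullet> w) *\<^sub>R w + (z \<bullet> J w) *\<^sub>R J w"
    by (simp add: vec2_eq_iff inner_vec2 algebra_simps)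
  ultimately show ?thesis
    by (metis (no_types, lifting) divideR_right scaleR_add_right scaleR_scaleR vector_fraction_eq_iff divide_inverse_commute)
qed

text \<open>The product of z with J v is the determinant of the matrix with columns v and z, that
  is, the area form.\<close>

lemma det_J: "(M *v z) \<bullet> J (M *v v) = det M * (z \<bullet> J v)"
  by (simp add: inner_vec2 mat2_mult_nth det_2 algebra_simps)

lemma det_pos_mult_nonzero:
  fixes M :: mat2 assumes "0 < det M" "v \<noteq> 0" shows "M *v v \<noteq> 0"
  using assms by (metis invertible_det_nz less_irrefl matrix_left_invertible_ker invertible_def)

section \<open>Products along orbits\<close>

lemma cocycle_add: "cocycle B T (m + n) x = cocycle B T m ((T ^^ n) x) ** cocycle B T n x"
  by (induct m) (simp_all add: funpow_add matrix_mul_assoc)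

lemma cocycle_Suc_right: "cocycle B T (Suc n) x = cocycle B T n (T x) ** B x"
  using cocycle_add[of B T n 1 x] by simp

lemma matrix_inv_mult:
  fixes M :: mat2
  assumes "invertible M" shows "matrix_inv M ** M = mat 1"
  using someI_ex[OF assms[unfolded invertible_def]] by (simp add: matrix_inv_def)

text \<open>The factor added last to the backward product is the inverse at the starting point, so
  the forward product is peeled from the right and the induction fixes the endpoint while the start
  varies.\<close>

lemma cocycle_neg_cancel:
  assumes inj: "\<And>x. inv T (T x) = x" and B: "\<And>x. invertible (B x :: mat2)"
  shows "cocycle_neg B T n ((T ^^ n) x) ** cocycle B T n x = mat 1"
proof -
  have pow: "(inv T ^^ m) ((T ^^ m) x) = x" for m x
    by (induct m arbitrary: x) (simp_all add: inj funpow_swap1)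
  have "cocycle_neg B T k y ** cocycle B T k x = mat 1" if "(T ^^ k) x = y" for k x y
    using that
  proof (induct k arbitrary: x)
    case (Suc k)
    have y: "(inv T ^^ Suc k) y = x" using pow[of "Suc k" x] Suc(2) by simp
    have "(T ^^ k) (T x) = y" using Suc(2) by (simp add: funpow_swap1)
    from Suc(1)[OF this] have IH: "cocycle_neg B T k y ** cocycle B T k (T x) = mat 1" .
    have "cocycle_neg B T (Suc k) y ** cocycle B T (Suc k) x
        = matrix_inv (B x) ** (cocycle_neg B T k y ** cocycle B T k (T x)) ** B x"
      unfolding cocycle_Suc_right cocycle_neg.simps y by (simp add: matrix_mul_assoc)
    also have "\<dots> = mat 1" unfolding IH using B by (simp add: matrix_inv_mult)
    finally show ?case .
  qed simp
  then show ?thesis by blast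
qed

section \<open>Lines, norms on them, and continuity\<close>

lemma span_scaleR_singleton: "c \<noteq> 0 \<Longrightarrow> span {c *\<^sub>R u} = span {u}"
  using span_image_scale[of "{u}" "\<lambda>_. c"] by simp

lemma image_span_singleton:
  fixes M :: mat2 assumes "M *v u = c *\<^sub>R u'" "c \<noteq> 0"
  shows "(\<lambda>v. M *v v) ` span {u} = span {u'}"
proof -
  have "(\<lambda>v. M *v v) ` span {u} = span ((\<lambda>v. M *v v) ` {u})"
    by (rule linear_span_image[symmetric]) simp
  then show ?thesis using assms span_scaleR_singleton by simp
qed

text \<open>All unit vectors of a line have images of equal norm, so the supremum is over a
  singleton.\<close>

lemma norm_restr_span:
  assumes "u \<noteq> 0" shows "norm_restr (span {u}) M = norm (M *v u) / norm u"
proof -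
  have "{norm (M *v v) | v. v \<in> span {u} \<and> norm v = 1} = {norm (M *v u) / norm u}"
  proof (intro equalityI subsetI)
    fix y assume "y \<in> {norm (M *v v) | v. v \<in> span {u} \<and> norm v = 1}"
    then obtain v where v: "y = norm (M *v v)" "v \<in> span {u}" "norm v = 1" by blast
    then obtain c where c: "v = c *\<^sub>R u" by (auto simp: span_singleton)
    then have "\<bar>c\<bar> = 1 / norm u" using v(3) assms by (simp add: field_simps)
    then show "y \<in> {norm (M *v u) / norm u}" by (simp add: v(1) c matrix_vector_mult_scaleR)
  next
    fix y assume "y \<in> {norm (M *v u) / norm u}"
    then have "y = norm (M *v ((1 / norm u) *\<^sub>R u))" by (simp add: matrix_vector_mult_scaleR)
    moreover have "(1 / norm u) *\<^sub>R u \<in> span {u}" by (intro span_mul span_base) simp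
    moreover have "norm ((1 / norm u) *\<^sub>R u) = 1" using assms by simp
    ultimately show "y \<in> {norm (M *v v) | v. v \<in> span {u} \<and> norm v = 1}" by blast
  qed
  then show ?thesis by (simp add: norm_restr_def)
qed

lemma span_singleton_eqD:
  assumes "span {u} = span {w}" "u \<noteq> (0 :: real^2)"
  shows "\<exists>c. c \<noteq> 0 \<and> u = c *\<^sub>R w"
proof -
  have "u \<in> span {w}" using assms(1) span_base[of u "{u}"] by simp
  then obtain c where "u = c *\<^sub>R w" by (auto simp: span_singleton)
  then show ?thesis using assms(2) by auto
qed

text \<open>An expression unchanged by rescaling its vectors depends on the lines alone. Near each
  point the chosen vectors can thus be replaced by continuous local ones.\<close>

lemma continuous_on_line_fields:
  fixes g :: "'a::t2_space \<Rightarrow> real^2 \<Rightarrow> real^2 \<Rightarrow> 'b::topological_space"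
  assumes E: "continuous_line_field (\<lambda>x. span {e x})" "\<And>x. e x \<noteq> 0"
    and F: "continuous_line_field (\<lambda>x. span {f x})" "\<And>x. f x \<noteq> 0"
    and hom: "\<And>x c c' w z. c \<noteq> 0 \<Longrightarrow> c' \<noteq> 0 \<Longrightarrow> g x (c *\<^sub>R w) (c' *\<^sub>R z) = g x w z"
    and loc: "\<And>U w z. continuous_on U w \<Longrightarrow> continuous_on U z \<Longrightarrow>
      (\<And>y. y \<in> U \<Longrightarrow> w y \<noteq> 0) \<Longrightarrow> (\<And>y. y \<in> U \<Longrightarrow> z y \<noteq> 0) \<Longrightarrow>
      continuous_on U (\<lambda>y. g y (w y) (z y))"
  shows "continuous_on UNIV (\<lambda>x. g x (e x) (f x))"
proof -
  have "isCont (\<lambda>x. g x (e x) (f x)) x0" for x0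
  proof -
    obtain U w where U: "open U" "x0 \<in> U" "continuous_on U w" "\<And>y. y \<in> U \<Longrightarrow> w y \<noteq> 0 \<and> span {e y} = span {w y}"
      using E(1) unfolding continuous_line_field_def by metis
    obtain V z where V: "open V" "x0 \<in> V" "continuous_on V z" "\<And>y. y \<in> V \<Longrightarrow> z y \<noteq> 0 \<and> span {f y} = span {z y}"
      using F(1) unfolding continuous_line_field_def by metis
    have "continuous_on (U \<inter> V) (\<lambda>y. g y (w y) (z y))"
      by (rule loc) (use U V in \<open>auto intro: continuous_on_subset\<close>)
    moreover have "g y (w y) (z y) = g y (e y) (f y)" if y: "y \<in> U \<inter> V" for y
    proof -
      have "span {e y} = span {w y}" "span {f y} = span {z y}" using U(4) V(4) y by auto
      then obtain c c' where "c \<noteq> 0" "e y = c *\<^sub>R w y" "c' \<noteq> 0" "f y = c' *\<^sub>R z y"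
        using span_singleton_eqD E(2) F(2) by metis
      then show ?thesis by (simp add: hom)
    qed
    ultimately have "continuous_on (U \<inter> V) (\<lambda>y. g y (e y) (f y))" by (rule continuous_on_eq)
    moreover have "open (U \<inter> V)" "x0 \<in> U \<inter> V" using U V by auto
    ultimately show ?thesis by (simp only: continuous_on_eq_continuous_at)
  qed
  then show ?thesis by (simp add: continuous_on_eq_continuous_at)
qed

text \<open>Block estimates multiply because both lines are invariant. The products avoid quotients;
  a nonzero f has nonzero images, whose norm can be cancelled.\<close>

lemma dominated_splitting_contraction:
  fixes A :: "'a::topological_space \<Rightarrow> mat2"
  assumes l: "\<And>x e f. e \<in> E x \<Longrightarrow> f \<in> F x \<Longrightarrow>
      norm (cocycle A T l x *v e) * norm f \<le> 1 / 2 * (norm e * norm (cocycle A T l x *v f))"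
    and EF: "\<And>x e. e \<in> E x \<Longrightarrow> A x *v e \<in> E (T x)" "\<And>x f. f \<in> F x \<Longrightarrow> A x *v f \<in> F (T x)"
    and nz: "\<And>x f. f \<noteq> 0 \<Longrightarrow> A x *v f \<noteq> 0"
    and ef: "e \<in> E x" "f \<in> F x"
  shows "norm (cocycle A T (l * m) x *v e) * norm f \<le> (1 / 2) ^ m * (norm e * norm (cocycle A T (l * m) x *v f))"
proof (cases "f = 0")
  case False
  have inv: "cocycle A T n x *v e \<in> E ((T ^^ n) x)" "cocycle A T n x *v f \<in> F ((T ^^ n) x)"
    "cocycle A T n x *v f \<noteq> 0" for n
    by (induct n) (use ef EF nz False in \<open>auto simp flip: matrix_vector_mul_assoc\<close>)
  show ?thesis
  proof (induct m)
    case (Suc m)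
    define y where "y = (T ^^ (l * m)) x"
    define e' where "e' = cocycle A T (l * m) x *v e"
    define f' where "f' = cocycle A T (l * m) x *v f"
    have step: "cocycle A T (l * Suc m) x *v v = cocycle A T l y *v (cocycle A T (l * m) x *v v)" for v
      by (simp add: cocycle_add y_def matrix_vector_mul_assoc)
    have "norm (cocycle A T l y *v e') * norm f' \<le> 1 / 2 * (norm e' * norm (cocycle A T l y *v f'))"
      using inv unfolding e'_def f'_def y_def by (intro l)
    then have "norm (cocycle A T l y *v e') * norm f' * norm f
        \<le> 1 / 2 * (norm e' * norm (cocycle A T l y *v f')) * norm f" by (intro mult_right_mono) auto
    also have "\<dots> = 1 / 2 * norm (cocycle A T l y *v f') * (norm e' * norm f)" by simp
    also have "\<dots> \<le> 1 / 2 * norm (cocycle A T l y *v f') * ((1 / 2) ^ m * (norm e * norm f'))"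
      using Suc by (intro mult_left_mono) (auto simp: e'_def f'_def)
    finally have "(norm (cocycle A T l y *v e') * norm f) * norm f'
        \<le> ((1 / 2) ^ Suc m * (norm e * norm (cocycle A T l y *v f'))) * norm f'" by (simp add: mult_ac)
    moreover have "0 < norm f'" using inv by (simp add: f'_def)
    ultimately show ?case by (simp only: step e'_def f'_def mult_le_cancel_right_pos)
  qed simp
qed simp

text \<open>In the frame \<open>(v, J v)\<close> adapted to the dominating line the cocycle is upper triangular.
  The coefficients \<open>b\<close> and \<open>d\<close> do not depend on the choice of the vectors \<open>v x\<close>, so they are
  continuous although the line field need not be orientable.\<close>

lemma dominated_splitting_triangular:
  fixes T :: "'a::metric_space \<Rightarrow> 'a" and A :: "'a \<Rightarrow> mat2"
  assumes cpt: "compact (UNIV :: 'a set)" and contT: "continuous_on UNIV T"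
    and invT: "\<And>x. inv T (T x) = x"
    and contA: "continuous_on UNIV A" and det: "\<And>x. 0 < det (A x)"
    and ds: "dominated_splitting T A"
  shows "\<exists>v b d W q. continuous_line_field (\<lambda>x. span {v x}) \<and> (\<forall>x. v x \<noteq> 0) \<and>
    (\<forall>x. \<exists>k. A x *v v x = k *\<^sub>R v (T x)) \<and>
    (\<forall>x. A x *v J (v x) = b x *\<^sub>R (A x *v v x) + d x *\<^sub>R J (A x *v v x)) \<and>
    continuous_on UNIV (\<lambda>x. norm (A x *v v x) / norm (v x)) \<and>
    continuous_on UNIV b \<and> continuous_on UNIV d \<and> continuous_on UNIV W \<and>
    (\<forall>x. 0 < d x) \<and> (\<forall>x. 0 < W x) \<and> 0 < q \<and> q < (1::real) \<and> (\<forall>x. d x * W (T x) \<le> q * W x)"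
proof -
  obtain E F l where EF: "continuous_line_field E" "continuous_line_field F"
    "\<And>x. E x \<inter> F x = {0}"
    "\<And>x. (\<lambda>v. A x *v v) ` E x = E (T x)" "\<And>x. (\<lambda>v. A x *v v) ` F x = F (T x)"
    "1 \<le> l" "\<And>x. norm_restr (E x) (cocycle A T l x) *
           norm_restr (F ((T ^^ l) x)) (cocycle_neg A T l ((T ^^ l) x)) < 1/2"
    using ds unfolding dominated_splitting_def by metis
  have "\<exists>e. e \<noteq> 0 \<and> L x = span {e}" if "continuous_line_field L" for L and x :: 'a
    using that unfolding continuous_line_field_def by metis
  then obtain e v where e: "\<And>x. e x \<noteq> 0" "\<And>x. E x = span {e x}" and v: "\<And>x. v x \<noteq> 0" "\<And>x. F x = span {v x}"
    using EF(1,2) by metis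
  have nz: "A x *v w \<noteq> 0" if "w \<noteq> 0" for x w using det_pos_mult_nonzero[OF det that] .
  have cnz: "cocycle A T n x *v w \<noteq> 0" if "w \<noteq> 0" for n x w
    by (induct n) (use that nz in \<open>auto simp flip: matrix_vector_mul_assoc\<close>)
  have invE: "cocycle A T n x *v w \<in> E ((T ^^ n) x)" if "w \<in> E x" for n x w
    by (induct n) (use that EF(4) in \<open>auto simp flip: matrix_vector_mul_assoc\<close>)
  have invF: "cocycle A T n x *v w \<in> F ((T ^^ n) x)" if "w \<in> F x" for n x w
    by (induct n) (use that EF(5) in \<open>auto simp flip: matrix_vector_mul_assoc\<close>)
  have F_span: "F x = span {w}" if w: "w \<in> F x" "w \<noteq> 0" for x w
  proof -
    obtain c where "w = c *\<^sub>R v x" using w(1) by (auto simp: v(2) span_singleton)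
    then show ?thesis using w(2) v(2) span_scaleR_singleton[of c "v x"] by auto
  qed
  have E_span: "E x = span {w}" if w: "w \<in> E x" "w \<noteq> 0" for x w
  proof -
    obtain c where "w = c *\<^sub>R e x" using w(1) by (auto simp: e(2) span_singleton)
    then show ?thesis using w(2) e(2) span_scaleR_singleton[of c "e x"] by auto
  qed
  \<comment> \<open>The backward cocycle on F returns the image of f' to f', so the product of
    restricted norms becomes a comparison of forward images.\<close>
  have half: "norm (cocycle A T l x *v e') * norm f' \<le> 1 / 2 * (norm e' * norm (cocycle A T l x *v f'))"
    if "e' \<in> E x" "f' \<in> F x" for x e' f'
  proof (cases "e' = 0 \<or> f' = 0")
    case False
    define g where "g = cocycle A T l x *v f'"
    have g: "g \<noteq> 0" "g \<in> F ((T ^^ l) x)" using cnz invF False that by (auto simp: g_def)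
    have "cocycle_neg A T l ((T ^^ l) x) ** cocycle A T l x = mat 1"
      using det invT by (intro cocycle_neg_cancel) (auto simp: invertible_det_nz less_imp_neq[symmetric])
    then have "cocycle_neg A T l ((T ^^ l) x) *v g = f'"
      by (simp add: g_def matrix_vector_mul_assoc)
    then have "norm (cocycle A T l x *v e') / norm e' * (norm f' / norm g) < 1 / 2"
      using EF(7)[of x] norm_restr_span[of e'] norm_restr_span[OF g(1)] E_span[of e' x] F_span[OF g(2,1)] False that
      by simp
    then have "norm (cocycle A T l x *v e') * norm f' / (norm e' * norm g) < 1 / 2" by simp
    then show ?thesis using False g(1) by (simp add: divide_less_eq g_def)
  qed auto
  have contraction: "norm (cocycle A T (l * m) x *v e') * norm f'
      \<le> (1 / 2) ^ m * (norm e' * norm (cocycle A T (l * m) x *v f'))"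
    if "e' \<in> E x" "f' \<in> F x" for m x e' f'
  proof (rule dominated_splitting_contraction[where E = E and F = F, OF half _ _ nz that])
    show "A x *v w \<in> E (T x)" if "w \<in> E x" for x w using EF(4) that by blast
    show "A x *v w \<in> F (T x)" if "w \<in> F x" for x w using EF(5) that by blast
  qed
  \<comment> \<open>These are the coordinates of A J v in the orthogonal basis (A v, J A v);
    \<open>det_J\<close> evaluates the second one.\<close>
  define b where "b x = ((A x *v J (v x)) \<bullet> (A x *v v x)) / ((A x *v v x) \<bullet> (A x *v v x))" for x
  define d where "d x = det (A x) * (v x \<bullet> v x) / ((A x *v v x) \<bullet> (A x *v v x))" for x
  define a where "a x = norm (A x *v v x) / norm (v x)" for x
  have "J (v x) \<bullet> J (v x) = v x \<bullet> v x" for x by (simp add: inner_vec2)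
  then have AJ: "A x *v J (v x) = b x *\<^sub>R (A x *v v x) + d x *\<^sub>R J (A x *v v x)" for x
    using J_decomp[of "A x *v v x" "A x *v J (v x)"] nz[OF v(1)[of x]] by (simp add: det_J b_def d_def)
  have Av: "\<exists>k. A x *v v x = k *\<^sub>R v (T x)" for x
  proof -
    have "A x *v v x \<in> F (T x)" using EF(5) v(2) span_base[of "v x" "{v x}"] by blast
    then show ?thesis by (auto simp: v(2) span_singleton)
  qed
  have lf: "continuous_line_field (\<lambda>x. span {v x})" "continuous_line_field (\<lambda>x. span {e x})"
    using EF(1,2) by (simp_all add: v(2)[abs_def] e(2)[abs_def])
  have cA: "continuous_on U A" for U using contA continuous_on_subset by blast
  have cAw: "continuous_on U (\<lambda>y. A y *v w y)" if "continuous_on U w" for U w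
    using cA that unfolding matrix_vector_mult_def sum_2
    by (intro continuous_intros continuous_on_vec_lambda continuous_on_component) auto
  have cb: "continuous_on UNIV b" unfolding b_def
  proof (rule continuous_on_line_fields[OF lf(1) v(1) lf(1) v(1), where g = "\<lambda>x w _. ((A x *v J w) \<bullet> (A x *v w)) / ((A x *v w) \<bullet> (A x *v w))"])
    fix U and w :: "'a \<Rightarrow> real^2" assume "continuous_on U w" "\<And>y. y \<in> U \<Longrightarrow> w y \<noteq> 0"
    then show "continuous_on U (\<lambda>y. ((A y *v J (w y)) \<bullet> (A y *v w y)) / ((A y *v w y) \<bullet> (A y *v w y)))"
      by (intro continuous_intros cAw continuous_on_J) (use nz in auto)
  qed (simp add: J_scaleR matrix_vector_mult_scaleR)
  have cdet: "continuous_on U (\<lambda>y. det (A y))" for U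
    unfolding det_2 by (intro continuous_intros continuous_on_component cA)
  have cd: "continuous_on UNIV d" unfolding d_def
  proof (rule continuous_on_line_fields[OF lf(1) v(1) lf(1) v(1), where g = "\<lambda>x w _. det (A x) * (w \<bullet> w) / ((A x *v w) \<bullet> (A x *v w))"])
    fix U and w :: "'a \<Rightarrow> real^2" assume "continuous_on U w" "\<And>y. y \<in> U \<Longrightarrow> w y \<noteq> 0"
    then show "continuous_on U (\<lambda>y. det (A y) * (w y \<bullet> w y) / ((A y *v w y) \<bullet> (A y *v w y)))"
      by (intro continuous_intros cAw cdet) (use nz in auto)
  qed (simp add: matrix_vector_mult_scaleR)
  have ca: "continuous_on UNIV a" unfolding a_def
  proof (rule continuous_on_line_fields[OF lf(1) v(1) lf(1) v(1), where g = "\<lambda>x w _. norm (A x *v w) / norm w"])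
    fix U and w :: "'a \<Rightarrow> real^2" assume "continuous_on U w" "\<And>y. y \<in> U \<Longrightarrow> w y \<noteq> 0"
    then show "continuous_on U (\<lambda>y. norm (A y *v w y) / norm (w y))"
      by (intro continuous_intros cAw) auto
  qed (simp add: matrix_vector_mult_scaleR)
  have dpos: "0 < d x" for x using det v(1) nz by (simp add: d_def)
  \<comment> \<open>The sine of the angle between the two lines: continuous, nowhere 0, hence
    bounded below on the compact space.\<close>
  define ang where "ang x = \<bar>e x \<bullet> J (v x)\<bar> / (norm (e x) * norm (v x))" for x
  have cang: "continuous_on UNIV ang" unfolding ang_def
  proof (rule continuous_on_line_fields[OF lf(2) e(1) lf(1) v(1), where g = "\<lambda>x w z. \<bar>w \<bullet> J z\<bar> / (norm w * norm z)"])
    fix U and w z :: "'a \<Rightarrow> real^2" assume "continuous_on U w" "continuous_on U z"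
      "\<And>y. y \<in> U \<Longrightarrow> w y \<noteq> 0" "\<And>y. y \<in> U \<Longrightarrow> z y \<noteq> 0"
    then show "continuous_on U (\<lambda>y. \<bar>w y \<bullet> J (z y)\<bar> / (norm (w y) * norm (z y)))"
      by (intro continuous_intros continuous_on_J) auto
  qed (simp add: J_scaleR abs_mult)
  have cross: "e x \<bullet> J (v x) \<noteq> 0" for x
  proof
    assume "e x \<bullet> J (v x) = 0"
    then have "e x = ((e x \<bullet> v x) / (v x \<bullet> v x)) *\<^sub>R v x" using J_decomp[OF v(1)[of x], of "e x"] by simp
    then have "e x \<in> F x" unfolding v(2) by (metis span_base span_mul singletonI)
    moreover have "e x \<in> E x" by (simp add: e(2) span_base)
    ultimately show False using EF(3)[of x] e(1)[of x] by blast
  qed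
  obtain x0 where x0: "\<And>x. ang x0 \<le> ang x"
    using continuous_attains_inf[OF cpt _ cang] by auto
  have ang0: "0 < ang x0" using cross e(1) v(1) by (simp add: ang_def)
  \<comment> \<open>The product of the \<open>d\<close> is the determinant of the cocycle divided by
    the square of its growth along \<open>v\<close>, written with the area form against a test
    vector z.\<close>
  have prod: "(\<Prod>i<n. d ((T ^^ i) x)) * (norm (cocycle A T n x *v v x))\<^sup>2 * (z \<bullet> J (v x))
      = (norm (v x))\<^sup>2 * ((cocycle A T n x *v z) \<bullet> J (cocycle A T n x *v v x))" for n x z
  proof (induct n)
    case (Suc n)
    define y where "y = (T ^^ n) x"
    define w where "w = cocycle A T n x *v v x"
    have "w \<in> F y" unfolding w_def y_def by (intro invF) (simp add: v(2) span_base)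
    then obtain c where c: "w = c *\<^sub>R v y" by (auto simp: v(2) span_singleton)
    have "d y * (norm (A y *v v y))\<^sup>2 = det (A y) * (norm (v y))\<^sup>2"
      using nz[OF v(1)[of y], of y] by (simp add: d_def power2_norm_eq_inner)
    then have dy: "d y * (norm (A y *v w))\<^sup>2 = det (A y) * (norm w)\<^sup>2"
      by (simp add: c matrix_vector_mult_scaleR power_mult_distrib)
    have "(\<Prod>i<Suc n. d ((T ^^ i) x)) * (norm (A y *v w))\<^sup>2 * (z \<bullet> J (v x))
        = (\<Prod>i<n. d ((T ^^ i) x)) * (d y * (norm (A y *v w))\<^sup>2) * (z \<bullet> J (v x))"
      by (simp add: y_def)
    also have "\<dots> = det (A y) * ((\<Prod>i<n. d ((T ^^ i) x)) * (norm w)\<^sup>2 * (z \<bullet> J (v x)))"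
      by (simp add: dy)
    also have "\<dots> = (norm (v x))\<^sup>2 * ((A y *v (cocycle A T n x *v z)) \<bullet> J (A y *v w))"
      using Suc by (simp add: w_def det_J)
    finally show ?case by (simp add: y_def w_def matrix_vector_mul_assoc)
  qed simp
  \<comment> \<open>Taking z in E, the area is bounded by domination up to the factor 1 / ang;
    enough blocks of length \<open>l\<close> beat that factor.\<close>
  obtain m where m: "(1 / 2) ^ m < ang x0 / 2"
    using real_arch_pow_inv[of "ang x0 / 2" "1 / 2"] ang0 by auto
  define N where "N = l * Suc m"
  have "0 < N" using EF(6) by (simp add: N_def)
  moreover have "(\<Prod>i<N. d ((T ^^ i) x)) \<le> 1 / 2" for x
  proof -
    define P where "P = (\<Prod>i<N. d ((T ^^ i) x))"
    define v' where "v' = cocycle A T N x *v v x"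
    define e' where "e' = cocycle A T N x *v e x"
    have P: "0 < P" unfolding P_def using dpos by (intro prod_pos) auto
    have v': "0 < norm v'" using cnz v(1) by (simp add: v'_def)
    have "P * (norm v')\<^sup>2 * \<bar>e x \<bullet> J (v x)\<bar> = \<bar>P * (norm v')\<^sup>2 * (e x \<bullet> J (v x))\<bar>"
      using P by (simp add: abs_mult)
    also have "\<dots> = (norm (v x))\<^sup>2 * \<bar>e' \<bullet> J v'\<bar>"
      unfolding P_def v'_def e'_def prod by (simp add: abs_mult)
    also have "\<dots> \<le> (norm (v x))\<^sup>2 * (norm e' * norm v')"
    proof (intro mult_left_mono)
      have "norm (J v') = norm v'" using norm_J_comb[of 0 v' 1] by simp
      then show "\<bar>e' \<bullet> J v'\<bar> \<le> norm e' * norm v'" using Cauchy_Schwarz_ineq2[of e' "J v'"] by simp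
    qed simp
    also have "\<dots> = norm (v x) * norm v' * (norm e' * norm (v x))" by (simp add: power2_eq_square)
    also have "\<dots> \<le> norm (v x) * norm v' * ((1 / 2) ^ Suc m * (norm (e x) * norm v'))"
      unfolding N_def v'_def e'_def
      by (intro mult_left_mono contraction) (auto simp: e(2) v(2) span_base)
    finally have "(P * \<bar>e x \<bullet> J (v x)\<bar>) * (norm v')\<^sup>2 \<le> ((1 / 2) ^ Suc m * (norm (e x) * norm (v x))) * (norm v')\<^sup>2"
      by (simp add: power2_eq_square mult_ac)
    then have "P * \<bar>e x \<bullet> J (v x)\<bar> \<le> (1 / 2) ^ Suc m * (norm (e x) * norm (v x))"
      using v' by (simp only: mult_le_cancel_right_pos zero_less_power)
    then have "P * ang x \<le> (1 / 2) ^ Suc m"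
      using e(1)[of x] v(1)[of x] by (simp add: ang_def divide_le_eq)
    also have "\<dots> \<le> 1 / 2 * ang x0" using m ang0 by simp
    also have "\<dots> \<le> 1 / 2 * ang x" using x0 by simp
    finally have "P \<le> 1 / 2" using ang0 x0[of x] by (simp only: mult_le_cancel_right_pos less_le_trans)
    then show ?thesis by (simp add: P_def)
  qed
  ultimately obtain W q where "continuous_on UNIV W" "\<forall>x. 0 < W x" "0 < q" "q < (1::real)" "\<forall>x. d x * W (T x) \<le> q * W x"
    using adapted_weight[OF contT cd dpos] by blast
  then show ?thesis
    using lf(1) v(1) Av AJ ca cb cd dpos unfolding a_def by blast
qed

section \<open>Rotated cocycles with dominated splitting\<close>

text \<open>Two almost sure limits agree at some point since the measure is not 0, so the
  description in \<open>upper_lyapunov\<close> is unique.\<close>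

lemma upper_lyapunov_eqI:
  assumes "prob_space M"
    and L: "AE x in M. (\<lambda>n. ln (onorm (\<lambda>v. cocycle B T n x *v v)) / real n) \<longlonglongrightarrow> L"
  shows "upper_lyapunov M T B = L"
  unfolding upper_lyapunov_def
proof (intro the_equality L)
  interpret prob_space M by fact
  fix L' assume "AE x in M. (\<lambda>n. ln (onorm (\<lambda>v. cocycle B T n x *v v)) / real n) \<longlonglongrightarrow> L'"
  then have "AE x in M. L' = L" using L by eventually_elim (rule LIMSEQ_unique)
  then show "L' = L" by simp
qed

locale rotated_cocycle = triangular_cocycle T "inv T" b d W \<rho> \<epsilon> R r r0
  for T :: "'a::metric_space \<Rightarrow> 'a" and b d W \<rho> \<epsilon> R r r0 +
  fixes A :: "'a \<Rightarrow> mat2" and v :: "'a \<Rightarrow> real^2"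
  assumes det_A: "0 < det (A x)"
    and v_nz: "v x \<noteq> 0" and line_v: "continuous_line_field (\<lambda>x. span {v x})"
    and A_v: "\<exists>k. A x *v v x = k *\<^sub>R v (T x)"
    and A_J: "A x *v J (v x) = b x *\<^sub>R (A x *v v x) + d x *\<^sub>R J (A x *v v x)"
    and cont_growth: "continuous_on UNIV (\<lambda>x. norm (A x *v v x) / norm (v x))"
begin

abbreviation rotA :: "real \<Rightarrow> 'a \<Rightarrow> mat2" where "rotA t \<equiv> \<lambda>x. A x ** rot t"

text \<open>The frame vector \<open>w\<close> is an argument because the unrotated \<open>A\<close>
  carries \<open>v x\<close> to a multiple of \<open>v (T x)\<close>: transporting \<open>w\<close>
  by \<open>A\<close> keeps these multiples out of the formulas.\<close>

definition fF :: "real \<Rightarrow> 'a \<Rightarrow> real^2 \<Rightarrow> real^2" where "fF t x w = w + s t x *\<^sub>R J w"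

definition fE :: "real \<Rightarrow> 'a \<Rightarrow> real^2 \<Rightarrow> real^2" where "fE t x w = p t x *\<^sub>R w + J w"

definition growth :: "'a \<Rightarrow> real" where "growth x = norm (A x *v v x) / norm (v x)"

lemma A_nz: "w \<noteq> 0 \<Longrightarrow> A x *v w \<noteq> 0"
  using det_pos_mult_nonzero[OF det_A] .

lemma growth_pos: "0 < growth x"
  using A_nz[OF v_nz] v_nz by (simp add: growth_def)

lemma fF_scaleR: "fF t x (c *\<^sub>R w) = c *\<^sub>R fF t x w"
  by (simp add: fF_def J_scaleR scaleR_add_right mult.commute)

lemma fE_scaleR: "fE t x (c *\<^sub>R w) = c *\<^sub>R fE t x w"
  by (simp add: fE_def J_scaleR scaleR_add_right mult.commute)

lemma norm_fF: "norm (fF t x w) = sqrt (1 + (s t x)\<^sup>2) * norm w"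
  using norm_J_comb[of 1 w "s t x"] by (simp add: fF_def)

lemma norm_fE: "norm (fE t x w) = sqrt ((p t x)\<^sup>2 + 1) * norm w"
  using norm_J_comb[of "p t x" w 1] by (simp add: fE_def)

lemma fF_nz: "w \<noteq> 0 \<Longrightarrow> fF t x w \<noteq> 0"
  using norm_fF[of t x w] by (metis add_pos_nonneg less_irrefl mult_pos_pos norm_zero real_sqrt_gt_zero zero_le_power2 zero_less_norm_iff zero_less_one)

lemma fE_nz: "w \<noteq> 0 \<Longrightarrow> fE t x w \<noteq> 0"
  using norm_fE[of t x w] by (metis add_nonneg_pos less_irrefl mult_pos_pos norm_zero real_sqrt_gt_zero zero_le_power2 zero_less_norm_iff zero_less_one)

lemma A_J_line:
  assumes "w \<in> span {v x}"
  shows "A x *v J w = b x *\<^sub>R (A x *v w) + d x *\<^sub>R J (A x *v w)"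
    and "A x *v w \<in> span {v (T x)}" and "norm (A x *v w) = growth x * norm w"
proof -
  obtain c where c: "w = c *\<^sub>R v x" using assms by (auto simp: span_singleton)
  show "A x *v J w = b x *\<^sub>R (A x *v w) + d x *\<^sub>R J (A x *v w)"
    by (simp add: c J_scaleR matrix_vector_mult_scaleR A_J scaleR_add_right mult.commute)
  obtain k where "A x *v v x = k *\<^sub>R v (T x)" using A_v by blast
  then show "A x *v w \<in> span {v (T x)}"
    by (simp add: c matrix_vector_mult_scaleR span_mul span_base)
  show "norm (A x *v w) = growth x * norm w"
    using v_nz[of x] by (simp add: c matrix_vector_mult_scaleR growth_def)
qed

lemma rotA_comb:
  assumes "w \<in> span {v x}"
  shows "rotA t x *v (\<alpha> *\<^sub>R w + \<beta> *\<^sub>R J w)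
    = (\<alpha> * cos t - \<beta> * sin t + b x * (\<alpha> * sin t + \<beta> * cos t)) *\<^sub>R (A x *v w)
      + (d x * (\<alpha> * sin t + \<beta> * cos t)) *\<^sub>R J (A x *v w)"
proof -
  have "rotA t x *v (\<alpha> *\<^sub>R w + \<beta> *\<^sub>R J w) = A x *v (rot t *v (\<alpha> *\<^sub>R w + \<beta> *\<^sub>R J w))"
    by (simp add: matrix_vector_mul_assoc)
  also have "rot t *v (\<alpha> *\<^sub>R w + \<beta> *\<^sub>R J w)
      = (\<alpha> * cos t - \<beta> * sin t) *\<^sub>R w + (\<alpha> * sin t + \<beta> * cos t) *\<^sub>R J w"
    by (simp add: rot_mult vec2_eq_iff algebra_simps)
  also have "A x *v \<dots> = (\<alpha> * cos t - \<beta> * sin t) *\<^sub>R (A x *v w)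
      + (\<alpha> * sin t + \<beta> * cos t) *\<^sub>R (b x *\<^sub>R (A x *v w) + d x *\<^sub>R J (A x *v w))"
    by (simp add: matrix_vector_right_distrib matrix_vector_mult_scaleR A_J_line(1)[OF assms])
  finally show ?thesis by (simp add: algebra_simps)
qed

text \<open>The fixed-point equation of \<open>s\<close> is invariance of the graph;
  \<open>den\<close> remains as the stretching factor relative to \<open>A\<close>.\<close>

lemma rotA_fF:
  assumes "\<bar>t\<bar> < r0" "w \<in> span {v x}"
  shows "rotA t x *v fF t x w = den x t (s t x) *\<^sub>R fF t (T x) (A x *v w)"
proof -
  have "den x t (s t x) * s t (T x) = d x * (sin t + s t x * cos t)"
    using s_eq[OF assms(1), of x] den_s_pos[OF assms(1), of x] by (simp add: num_def)
  then show ?thesis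
    using rotA_comb[OF assms(2), of t 1 "s t x"]
    by (simp add: fF_def den_def scaleR_add_right)
qed

text \<open>With D = \<open>denE\<close>, invariance says that (p, 1) is (m, 1) / D rotated by -t.
  Rotating back gives m / D and 1 / D, and the triangular map turns these into d / D times (p at T
  x, 1).\<close>

lemma rotA_fE:
  assumes t: "\<bar>t\<bar> < r0" and w: "w \<in> span {v x}"
  shows "rotA t x *v fE t x w = (d x / denE x t (p t (T x))) *\<^sub>R fE t (T x) (A x *v w)"
proof -
  define D where "D = denE x t (p t (T x))"
  define m where "m = d x * p t (T x) - b x"
  have D: "D = cos t - sin t * m" "0 < D" using denE_p_pos[OF t, of x] by (simp_all add: D_def denE_def m_def)
  have p: "p t x = (sin t + cos t * m) / D"
    using p_eq[OF t, of x] D(2) by (simp add: D_def m_def field_simps)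
  have sc: "(sin t)\<^sup>2 + (cos t)\<^sup>2 = 1" by simp
  have "D * (p t x * sin t + cos t) = (sin t + cos t * m) * sin t + cos t * D"
    using D(2) by (simp add: p field_simps)
  also have "\<dots> = (sin t)\<^sup>2 + (cos t)\<^sup>2" by (simp add: D(1) algebra_simps power2_eq_square)
  finally have 1: "p t x * sin t + cos t = 1 / D" using D(2) by (simp add: field_simps)
  have "D * (p t x * cos t - sin t) = (sin t + cos t * m) * cos t - sin t * D"
    using D(2) by (simp add: p field_simps)
  also have "\<dots> = m * ((sin t)\<^sup>2 + (cos t)\<^sup>2)" unfolding D(1) power2_eq_square by algebra
  finally have 2: "p t x * cos t - sin t = m / D" using D(2) by (simp add: field_simps)
  have "p t x * cos t - sin t + b x * (p t x * sin t + cos t) = d x / D * p t (T x)"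
    unfolding 1 2 by (simp add: m_def diff_divide_distrib)
  then show ?thesis
    using rotA_comb[OF w, of t "p t x" 1] 1 by (simp add: fE_def D_def scaleR_add_right)
qed

lemma cocycle_A_line:
  assumes "w \<in> span {v x}"
  shows "cocycle A T n x *v w \<in> span {v ((T ^^ n) x)}"
    and "norm (cocycle A T n x *v w) = (\<Prod>i<n. growth ((T ^^ i) x)) * norm w"
proof -
  have *: "cocycle A T n x *v w \<in> span {v ((T ^^ n) x)} \<and>
    norm (cocycle A T n x *v w) = (\<Prod>i<n. growth ((T ^^ i) x)) * norm w"
    using assms A_J_line(2,3) by (induct n) (auto simp flip: matrix_vector_mul_assoc)
  then show "cocycle A T n x *v w \<in> span {v ((T ^^ n) x)}"
    "norm (cocycle A T n x *v w) = (\<Prod>i<n. growth ((T ^^ i) x)) * norm w" by auto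
qed

lemma cocycle_fF:
  assumes "\<bar>t\<bar> < r0" "w \<in> span {v x}"
  shows "cocycle (rotA t) T n x *v fF t x w =
    (\<Prod>i<n. den ((T ^^ i) x) t (s t ((T ^^ i) x))) *\<^sub>R fF t ((T ^^ n) x) (cocycle A T n x *v w)"
proof (induct n)
  case (Suc n)
  then show ?case
    using rotA_fF[OF assms(1) cocycle_A_line(1)[OF assms(2), of n]]
    by (simp add: matrix_vector_mult_scaleR mult.commute flip: matrix_vector_mul_assoc)
qed simp

lemma cocycle_fE:
  assumes "\<bar>t\<bar> < r0" "w \<in> span {v x}"
  shows "cocycle (rotA t) T n x *v fE t x w =
    (\<Prod>i<n. d ((T ^^ i) x) / denE ((T ^^ i) x) t (p t (T ((T ^^ i) x)))) *\<^sub>R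
      fE t ((T ^^ n) x) (cocycle A T n x *v w)"
proof (induct n)
  case (Suc n)
  then show ?case
    using rotA_fE[OF assms(1) cocycle_A_line(1)[OF assms(2), of n]]
    by (simp add: matrix_vector_mult_scaleR mult.commute flip: matrix_vector_mul_assoc)
qed simp

section \<open>Domination for the rotated cocycle\<close>

text \<open>The ratio of the two stretching factors is d / (denE * den), which
  \<open>contr_div\<close> bounds; the weights telescope along the orbit.\<close>

lemma prod_contraction:
  assumes t: "\<bar>t\<bar> < r0"
  shows "(\<Prod>i<n. d ((T ^^ i) x) / denE ((T ^^ i) x) t (p t (T ((T ^^ i) x)))) * W ((T ^^ n) x)
    \<le> \<rho> ^ n * W x * (\<Prod>i<n. den ((T ^^ i) x) t (s t ((T ^^ i) x)))"
proof (induct n)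
  case (Suc n)
  define y where "y = (T ^^ n) x"
  define P where "P = (\<Prod>i<n. d ((T ^^ i) x) / denE ((T ^^ i) x) t (p t (T ((T ^^ i) x))))"
  define Q where "Q = (\<Prod>i<n. den ((T ^^ i) x) t (s t ((T ^^ i) x)))"
  define D1 where "D1 = denE y t (p t (T y))"
  define D2 where "D2 = den y t (s t y)"
  have D: "1 - \<epsilon> \<le> D1" "1 - \<epsilon> \<le> D2" "0 < D1" "0 < D2"
    unfolding D1_def D2_def using t denE_p_ge den_s_ge denE_p_pos den_s_pos by auto
  have P: "0 \<le> P" unfolding P_def using d_pos denE_p_pos[OF t] by (intro prod_nonneg) (auto simp: less_imp_le)
  have "d y / D1 * W (T y) = D2 * (d y / (D1 * D2) * W (T y))" using D by simp
  also have "\<dots> \<le> D2 * (\<rho> * W y)" using contr_div[OF D(1,2), of y] D(4) by (intro mult_left_mono) auto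
  finally have "P * (d y / D1 * W (T y)) \<le> P * (D2 * (\<rho> * W y))" using P by (intro mult_left_mono)
  also have "\<dots> = D2 * \<rho> * (P * W y)" by simp
  also have "\<dots> \<le> D2 * \<rho> * (\<rho> ^ n * W x * Q)"
    using Suc D(4) \<rho> by (intro mult_left_mono) (auto simp: P_def Q_def y_def)
  finally show ?case by (simp add: P_def Q_def y_def D1_def D2_def mult_ac)
qed simp

text \<open>The growth of \<open>A\<close> along \<open>v\<close> is common to both lines and
  cancels. \<open>C\<close> collects the bounds on \<open>W\<close> and on the lengths of the graph
  vectors.\<close>

lemma domination_estimate:
  assumes t: "\<bar>t\<bar> < r0"
  shows "\<exists>C>0. \<forall>n x. norm (cocycle (rotA t) T n x *v fE t x (v x)) * norm (fF t x (v x))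
    \<le> C * \<rho> ^ n * (norm (fE t x (v x)) * norm (cocycle (rotA t) T n x *v fF t x (v x)))"
proof -
  obtain x0 where x0: "\<And>x. W x0 \<le> W x" using continuous_attains_inf[OF cpt _ cont_W] by auto
  define P where "P = (R * W_sup)\<^sup>2"
  define C where "C = W_sup / W x0 * (sqrt (P + 1) * sqrt 2)"
  have P: "(p t x)\<^sup>2 \<le> P" for x
  proof -
    have "\<bar>p t x\<bar> \<le> R * W_sup" using p_bound[OF t, of x] W_le[of x] R_pos
      by (meson less_imp_le mult_left_mono order_trans)
    then show ?thesis unfolding P_def by (metis abs_ge_zero power2_abs power_mono)
  qed
  have s1: "(s t x)\<^sup>2 \<le> 1" for x
    using abs_lt_1[OF s_bound[OF t], of x] by (simp add: abs_square_le_1 less_imp_le)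
  have Ws: "0 < W_sup" using W_le[of x0] W_pos[of x0] by linarith
  have C: "0 < C" unfolding C_def P_def using Ws W_pos[of x0] by (intro mult_pos_pos divide_pos_pos) (auto intro: add_nonneg_pos)
  have "norm (cocycle (rotA t) T n x *v fE t x (v x)) * norm (fF t x (v x))
    \<le> C * \<rho> ^ n * (norm (fE t x (v x)) * norm (cocycle (rotA t) T n x *v fF t x (v x)))" for n x
  proof -
    have vs: "v x \<in> span {v x}" by (simp add: span_base)
    define y where "y = (T ^^ n) x"
    define p' where "p' = (\<Prod>i<n. d ((T ^^ i) x) / denE ((T ^^ i) x) t (p t (T ((T ^^ i) x))))"
    define q' where "q' = (\<Prod>i<n. den ((T ^^ i) x) t (s t ((T ^^ i) x)))"
    define g where "g = norm (cocycle A T n x *v v x) * norm (v x)"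
    have p': "0 \<le> p'" unfolding p'_def using d_pos denE_p_pos[OF t] by (intro prod_nonneg) (auto simp: less_imp_le)
    have q': "0 \<le> q'" unfolding q'_def using den_s_pos[OF t] by (intro prod_nonneg) (auto simp: less_imp_le)
    have "p' * W x0 \<le> p' * W y" using p' x0 by (intro mult_left_mono) auto
    also have "\<dots> \<le> \<rho> ^ n * W x * q'" using prod_contraction[OF t, of x n] by (simp add: p'_def q'_def y_def)
    also have "\<dots> \<le> \<rho> ^ n * W_sup * q'" using W_le q' \<rho> by (intro mult_right_mono mult_left_mono) auto
    finally have pq: "p' \<le> W_sup / W x0 * (\<rho> ^ n * q')" using W_pos[of x0] by (simp add: field_simps)
    have "norm (cocycle (rotA t) T n x *v fE t x (v x)) * norm (fF t x (v x))
        = p' * (sqrt ((p t y)\<^sup>2 + 1) * sqrt (1 + (s t x)\<^sup>2)) * g"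
      unfolding cocycle_fE[OF t vs] using p' by (simp add: norm_fE norm_fF p'_def y_def g_def)
    also have "\<dots> \<le> (W_sup / W x0 * (\<rho> ^ n * q')) * (sqrt (P + 1) * sqrt 2) * g"
      using pq p' P[of y] s1[of x] Ws W_pos[of x0] \<rho> q' by (intro mult_right_mono mult_mono) (auto simp: g_def P_def)
    also have "\<dots> = C * \<rho> ^ n * (q' * g)" by (simp add: C_def)
    also have "\<dots> \<le> C * \<rho> ^ n * (norm (fE t x (v x)) * norm (cocycle (rotA t) T n x *v fF t x (v x)))"
    proof (intro mult_left_mono)
      have "1 * (q' * g) * 1 \<le> sqrt ((p t x)\<^sup>2 + 1) * (q' * g) * sqrt (1 + (s t y)\<^sup>2)"
        using q' by (intro mult_mono) (auto simp: g_def)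
      then show "q' * g \<le> norm (fE t x (v x)) * norm (cocycle (rotA t) T n x *v fF t x (v x))"
        unfolding cocycle_fF[OF t vs] using q'
        by (simp add: norm_fE norm_fF q'_def y_def g_def mult_ac)
    qed (use C \<rho> in auto)
    finally show ?thesis .
  qed
  with C show ?thesis by blast
qed

lemma line_field_frame:
  assumes h: "\<And>x c w. h x (c *\<^sub>R w) = c *\<^sub>R h x w" and nz: "\<And>x w. w \<noteq> 0 \<Longrightarrow> h x w \<noteq> 0"
    and cont: "\<And>U w. continuous_on U w \<Longrightarrow> continuous_on U (\<lambda>x. h x (w x))"
  shows "continuous_line_field (\<lambda>x. span {h x (v x)})"
  unfolding continuous_line_field_def
proof
  fix x0
  obtain U w where U: "open U" "x0 \<in> U" "continuous_on U w" "\<And>y. y \<in> U \<Longrightarrow> w y \<noteq> 0 \<and> span {v y} = span {w y}"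
    using line_v unfolding continuous_line_field_def by metis
  have "span {h y (v y)} = span {h y (w y)}" if "y \<in> U" for y
    using span_singleton_eqD[of "v y" "w y"] U(4)[OF that] v_nz[of y] by (auto simp: h span_scaleR_singleton)
  then show "\<exists>U w. open U \<and> x0 \<in> U \<and> continuous_on U w \<and>
      (\<forall>y\<in>U. w y \<noteq> 0 \<and> span {h y (v y)} = span {w y})"
    using U nz cont[OF U(3)] by (intro exI[of _ U] exI[of _ "\<lambda>y. h y (w y)"]) auto
qed

lemma dominated_splitting_rotA:
  assumes t: "\<bar>t\<bar> < r0"
  shows "dominated_splitting T (rotA t)"
proof -
  define E where "E = (\<lambda>x. span {fE t x (v x)})"
  define F where "F = (\<lambda>x. span {fF t x (v x)})"
  have vs: "v x \<in> span {v x}" for x by (simp add: span_base)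
  have "continuous_line_field E" unfolding E_def
    by (rule line_field_frame)
       (auto simp: fE_scaleR fE_nz, auto simp: fE_def intro!: continuous_intros continuous_on_J
         continuous_on_subset[OF continuous_p[OF t]])
  moreover have "continuous_line_field F" unfolding F_def
    by (rule line_field_frame)
       (auto simp: fF_scaleR fF_nz, auto simp: fF_def intro!: continuous_intros continuous_on_J
         continuous_on_subset[OF continuous_s[OF t]])
  moreover have "E x \<inter> F x = {0}" for x
  proof -
    have "u = 0" if "u \<in> E x" "u \<in> F x" for u
    proof -
      obtain c where c1: "u = c *\<^sub>R fE t x (v x)"
        using \<open>u \<in> E x\<close> unfolding E_def span_singleton by blast
      obtain c' where c2: "u = c' *\<^sub>R fF t x (v x)"
        using \<open>u \<in> F x\<close> unfolding F_def span_singleton by blast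
      have vv: "v x \<bullet> v x \<noteq> 0" "J (v x) \<bullet> J (v x) = v x \<bullet> v x" "v x \<bullet> J (v x) = 0" "J (v x) \<bullet> v x = 0"
        using v_nz[of x] by (simp, simp_all add: inner_vec2)
      have "u \<bullet> v x = c * p t x * (v x \<bullet> v x)" "u \<bullet> J (v x) = c * (v x \<bullet> v x)"
        using vv(2-4) unfolding c1 fE_def by (simp_all add: inner_add_left)
      moreover have "u \<bullet> v x = c' * (v x \<bullet> v x)" "u \<bullet> J (v x) = c' * s t x * (v x \<bullet> v x)"
        using vv(2-4) unfolding c2 fF_def by (simp_all add: inner_add_left)
      ultimately have "c' = c * p t x" "c = c' * s t x" using vv(1) by auto
      then have "c * (1 - p t x * s t x) = 0" by algebra
      then have "c = 0" using one_minus_ps_pos[OF t t, of x] by simp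
      then show ?thesis using c1 by simp
    qed
    moreover have "0 \<in> E x" "0 \<in> F x" by (auto simp: E_def F_def span_zero)
    ultimately show ?thesis by blast
  qed
  moreover have k: "\<exists>k. k \<noteq> 0 \<and> A x *v v x = k *\<^sub>R v (T x)" for x
    using A_v[of x] A_nz[OF v_nz, of x x] by auto
  moreover have "(\<lambda>u. rotA t x *v u) ` E x = E (T x)" for x
  proof -
    obtain k where "k \<noteq> 0" "A x *v v x = k *\<^sub>R v (T x)" using k by blast
    then show ?thesis unfolding E_def
      using d_pos[of x] denE_p_pos[OF t, of x]
      by (intro image_span_singleton[where c = "d x / denE x t (p t (T x)) * k"])
         (simp_all only: rotA_fE[OF t vs] fE_scaleR scaleR_scaleR, simp)
  qed
  moreover have "(\<lambda>u. rotA t x *v u) ` F x = F (T x)" for x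
  proof -
    obtain k where "k \<noteq> 0" "A x *v v x = k *\<^sub>R v (T x)" using k by blast
    then show ?thesis unfolding F_def
      using den_s_pos[OF t, of x]
      by (intro image_span_singleton[where c = "den x t (s t x) * k"])
         (simp_all only: rotA_fF[OF t vs] fF_scaleR scaleR_scaleR, simp)
  qed
  moreover have "\<exists>l::nat. l \<ge> 1 \<and> (\<forall>x. norm_restr (E x) (cocycle (rotA t) T l x) *
      norm_restr (F ((T ^^ l) x)) (cocycle_neg (rotA t) T l ((T ^^ l) x)) < 1/2)"
  proof -
    obtain C where C: "C > 0" "\<And>n x. norm (cocycle (rotA t) T n x *v fE t x (v x)) * norm (fF t x (v x))
      \<le> C * \<rho> ^ n * (norm (fE t x (v x)) * norm (cocycle (rotA t) T n x *v fF t x (v x)))"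
      using domination_estimate[OF t] by blast
    obtain m where m: "\<rho> ^ m < 1 / (2 * C)" using real_arch_pow_inv[of "1 / (2 * C)" \<rho>] C(1) \<rho> by auto
    \<comment> \<open>The successor guarantees l >= 1, since \<open>m\<close> may be 0.\<close>
    define l where "l = Suc m"
    have "\<rho> ^ l \<le> \<rho> ^ m" using \<rho> by (simp add: l_def mult_le_cancel_right1)
    then have "C * \<rho> ^ l \<le> C * \<rho> ^ m" using C(1) by simp
    also have "\<dots> < 1 / 2" using m C(1) by (simp add: field_simps)
    finally have l: "C * \<rho> ^ l < 1 / 2" .
    have "norm_restr (E x) (cocycle (rotA t) T l x) *
      norm_restr (F ((T ^^ l) x)) (cocycle_neg (rotA t) T l ((T ^^ l) x)) < 1/2" for x
    proof -
      define e where "e = fE t x (v x)"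
      define f where "f = fF t x (v x)"
      define g where "g = cocycle (rotA t) T l x *v f"
      have "cocycle A T l x *v v x \<in> span {v ((T ^^ l) x)}" by (rule cocycle_A_line(1)[OF vs])
      then obtain k where k: "cocycle A T l x *v v x = k *\<^sub>R v ((T ^^ l) x)" by (auto simp: span_singleton)
      have "k \<noteq> 0"
      proof
        assume "k = 0"
        then have "norm (cocycle A T l x *v v x) = 0" using k by simp
        moreover have "0 < (\<Prod>i<l. growth ((T ^^ i) x)) * norm (v x)"
          using growth_pos v_nz by (intro mult_pos_pos prod_pos) auto
        ultimately show False using cocycle_A_line(2)[OF vs, of l x] by linarith
      qed
      \<comment> \<open>A nonzero multiple relates the image of f to the spanning vector at the
        endpoint, so the image itself spans F there.\<close>
      define q where "q = (\<Prod>i<l. den ((T ^^ i) x) t (s t ((T ^^ i) x))) * k"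
      have "0 < (\<Prod>i<l. den ((T ^^ i) x) t (s t ((T ^^ i) x)))"
        using den_s_pos[OF t] by (intro prod_pos) auto
      then have q: "q \<noteq> 0" using \<open>k \<noteq> 0\<close> unfolding q_def by (metis less_irrefl mult_eq_0_iff)
      have gq: "g = q *\<^sub>R fF t ((T ^^ l) x) (v ((T ^^ l) x))"
        unfolding g_def f_def cocycle_fF[OF t vs] k fF_scaleR q_def by simp
      have nz: "e \<noteq> 0" "f \<noteq> 0" "g \<noteq> 0" using q by (auto simp: e_def f_def gq fE_nz fF_nz v_nz)
      have Fg: "F ((T ^^ l) x) = span {g}" 
        unfolding F_def gq by (rule span_scaleR_singleton[OF q, symmetric])
      have rot: "det (rot t) = 1" by (simp add: det_2 rot_def flip: power2_eq_square)
      have "cocycle_neg (rotA t) T l ((T ^^ l) x) ** cocycle (rotA t) T l x = mat 1"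
        by (intro cocycle_neg_cancel Ti_T) (simp add: invertible_det_nz det_mul rot less_imp_neq[OF det_A, symmetric])
      then have neg: "cocycle_neg (rotA t) T l ((T ^^ l) x) *v g = f"
        by (simp add: g_def matrix_vector_mul_assoc)
      have "norm (cocycle (rotA t) T l x *v e) * norm f \<le> C * \<rho> ^ l * (norm e * norm g)"
        using C(2)[of l x] by (simp add: e_def f_def g_def)
      then have "norm (cocycle (rotA t) T l x *v e) / norm e * (norm f / norm g) \<le> C * \<rho> ^ l"
        using nz by (simp add: divide_le_eq)
      then show ?thesis
        unfolding Fg norm_restr_span[OF nz(3)] neg
        unfolding E_def e_def[symmetric] norm_restr_span[OF nz(1)] using l by linarith
    qed
    then show ?thesis by (intro exI[of _ l]) (auto simp: l_def)
  qed
  ultimately show ?thesis unfolding dominated_splitting_def by blast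
qed

section \<open>The exponent as an integral\<close>

text \<open>The constants may depend on \<open>x\<close> but not on n, which suffices after dividing
  the logarithm by n. The dominating vector f gives the lower bound; for the upper one the dominated
  vector e grows no faster than f up to a constant.\<close>

lemma onorm_cocycle_bounds:
  assumes t: "\<bar>t\<bar> < r0"
  shows "\<exists>c C. 0 < c \<and> 0 < C \<and> (\<forall>n. 
    c * (\<Prod>i<n. growth ((T ^^ i) x) * den ((T ^^ i) x) t (s t ((T ^^ i) x))) \<le> onorm (\<lambda>w. cocycle (rotA t) T n x *v w)
    \<and> onorm (\<lambda>w. cocycle (rotA t) T n x *v w) \<le>
      C * (\<Prod>i<n. growth ((T ^^ i) x) * den ((T ^^ i) x) t (s t ((T ^^ i) x))))"
proof -
  obtain K where K: "K > 0" "\<And>n x. norm (cocycle (rotA t) T n x *v fE t x (v x)) * norm (fF t x (v x))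
      \<le> K * \<rho> ^ n * (norm (fE t x (v x)) * norm (cocycle (rotA t) T n x *v fF t x (v x)))"
    using domination_estimate[OF t] by blast
  have vs: "v x \<in> span {v x}" by (simp add: span_base)
  define e where "e = fE t x (v x)"
  define f where "f = fF t x (v x)"
  define k where "k = 1 - p t x * s t x"
  have k: "0 < k" using one_minus_ps_pos[OF t t] by (simp add: k_def)
  define pr where "pr n = (\<Prod>i<n. growth ((T ^^ i) x) * den ((T ^^ i) x) t (s t ((T ^^ i) x)))" for n
  have pr: "0 < pr n" for n
    unfolding pr_def using growth_pos den_s_pos[OF t] by (intro prod_pos) auto
  have nz: "e \<noteq> 0" "f \<noteq> 0" by (auto simp: e_def f_def fE_nz fF_nz v_nz)
  have Mf: "norm (cocycle (rotA t) T n x *v f) = sqrt (1 + (s t ((T ^^ n) x))\<^sup>2) * norm (v x) * pr n" for n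
  proof -
    have "0 < (\<Prod>i<n. den ((T ^^ i) x) t (s t ((T ^^ i) x)))" using den_s_pos[OF t] by (intro prod_pos) auto
    then show ?thesis unfolding f_def cocycle_fF[OF t vs]
      by (simp add: norm_fF cocycle_A_line(2)[OF vs] pr_def prod.distrib)
  qed
  have s1: "sqrt (1 + (s t y)\<^sup>2) \<le> sqrt 2" for y
    using abs_lt_1[OF s_bound[OF t], of y] by (simp add: abs_square_le_1 less_imp_le)
  have low: "norm (v x) * pr n \<le> norm (cocycle (rotA t) T n x *v f)" for n
  proof -
    have "1 * (norm (v x) * pr n) \<le> sqrt (1 + (s t ((T ^^ n) x))\<^sup>2) * (norm (v x) * pr n)"
      using pr[of n] by (intro mult_right_mono) auto
    then show ?thesis unfolding Mf by (simp add: mult.assoc)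
  qed
  have f_up: "norm (cocycle (rotA t) T n x *v f) \<le> sqrt 2 * norm (v x) * pr n" for n
    unfolding Mf using s1 pr[of n] by (intro mult_right_mono) auto
  have e_up: "norm (cocycle (rotA t) T n x *v e) \<le> K * norm e / norm f * (sqrt 2 * norm (v x)) * pr n" for n
  proof -
    have "norm (cocycle (rotA t) T n x *v e) * norm f
        \<le> K * \<rho> ^ n * (norm e * norm (cocycle (rotA t) T n x *v f))"
      using K(2)[of n x] by (simp add: e_def f_def)
    also have "\<dots> \<le> K * 1 * (norm e * (sqrt 2 * norm (v x) * pr n))"
      using K(1) \<rho> f_up[of n] by (intro mult_mono) (auto simp: power_le_one)
    finally show ?thesis using nz by (simp add: field_simps)
  qed
  define C1 where "C1 = sqrt 2 * norm (v x)"
  define C2 where "C2 = K * norm e / norm f * (sqrt 2 * norm (v x))"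
  define Cv where "Cv = (C1 + \<bar>s t x\<bar> * C2) / k"
  define CJ where "CJ = (C2 + \<bar>p t x\<bar> * C1) / k"
  define C where "C = (Cv + CJ) / norm (v x)"
  have C1: "0 < C1" "0 < C2" using v_nz K(1) nz by (simp_all add: C1_def C2_def)
  have Cp: "0 < C" unfolding C_def Cv_def CJ_def using C1 k v_nz[of x]
    by (intro divide_pos_pos add_pos_pos add_pos_nonneg) auto
  \<comment> \<open>Cramer's rule with determinant k = 1 - p s returns from the invariant vectors to
    the orthogonal frame.\<close>
  have kv: "k *\<^sub>R v x = f - s t x *\<^sub>R e" "k *\<^sub>R J (v x) = e - p t x *\<^sub>R f"
    by (simp_all add: k_def e_def f_def fE_def fF_def algebra_simps)
  have v_up: "norm (cocycle (rotA t) T n x *v v x) \<le> Cv * pr n" for n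
  proof -
    let ?M = "cocycle (rotA t) T n x"
    have "k * norm (?M *v v x) = norm (?M *v (k *\<^sub>R v x))" using k by (simp add: matrix_vector_mult_scaleR)
    also have "\<dots> = norm (?M *v f - s t x *\<^sub>R (?M *v e))"
      unfolding kv by (simp add: matrix_vector_mult_diff_distrib matrix_vector_mult_scaleR)
    also have "\<dots> \<le> norm (?M *v f) + \<bar>s t x\<bar> * norm (?M *v e)"
      using norm_triangle_ineq4[of "?M *v f" "s t x *\<^sub>R (?M *v e)"] by simp
    also have "\<dots> \<le> C1 * pr n + \<bar>s t x\<bar> * (C2 * pr n)"
      using e_up[of n] f_up[of n] by (intro add_mono mult_left_mono) (auto simp: C1_def C2_def)
    finally show ?thesis using k by (simp add: Cv_def field_simps)
  qed
  have J_up: "norm (cocycle (rotA t) T n x *v J (v x)) \<le> CJ * pr n" for n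
  proof -
    let ?M = "cocycle (rotA t) T n x"
    have "k * norm (?M *v J (v x)) = norm (?M *v (k *\<^sub>R J (v x)))" using k by (simp add: matrix_vector_mult_scaleR)
    also have "\<dots> = norm (?M *v e - p t x *\<^sub>R (?M *v f))"
      unfolding kv by (simp add: matrix_vector_mult_diff_distrib matrix_vector_mult_scaleR)
    also have "\<dots> \<le> norm (?M *v e) + \<bar>p t x\<bar> * norm (?M *v f)"
      using norm_triangle_ineq4[of "?M *v e" "p t x *\<^sub>R (?M *v f)"] by simp
    also have "\<dots> \<le> C2 * pr n + \<bar>p t x\<bar> * (C1 * pr n)"
      using e_up[of n] f_up[of n] by (intro add_mono mult_left_mono) (auto simp: C1_def C2_def)
    finally show ?thesis using k by (simp add: CJ_def field_simps)
  qed
  have upper: "onorm (\<lambda>w. cocycle (rotA t) T n x *v w) \<le> C * pr n" for n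
  proof (rule onorm_le)
    fix z
    let ?M = "cocycle (rotA t) T n x"
    define \<alpha> where "\<alpha> = (z \<bullet> v x) / (v x \<bullet> v x)"
    define \<beta> where "\<beta> = (z \<bullet> J (v x)) / (v x \<bullet> v x)"
    have nJ: "norm (J (v x)) = norm (v x)" using norm_J_comb[of 0 "v x" 1] by simp
    have "\<bar>z \<bullet> v x\<bar> \<le> norm z * norm (v x)" by (rule Cauchy_Schwarz_ineq2)
    then have \<alpha>: "\<bar>\<alpha>\<bar> \<le> norm z / norm (v x)"
      using v_nz[of x] by (simp add: \<alpha>_def divide_simps mult_ac flip: power2_norm_eq_inner) (simp add: power2_eq_square)
    have "\<bar>z \<bullet> J (v x)\<bar> \<le> norm z * norm (v x)" using Cauchy_Schwarz_ineq2[of z "J (v x)"] nJ by simp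
    then have \<beta>: "\<bar>\<beta>\<bar> \<le> norm z / norm (v x)"
      using v_nz[of x] by (simp add: \<beta>_def divide_simps mult_ac flip: power2_norm_eq_inner) (simp add: power2_eq_square)
    have "?M *v z = \<alpha> *\<^sub>R (?M *v v x) + \<beta> *\<^sub>R (?M *v J (v x))"
      by (subst J_decomp[OF v_nz[of x], of z])
         (simp add: \<alpha>_def \<beta>_def matrix_vector_right_distrib matrix_vector_mult_scaleR)
    also have "norm \<dots> \<le> \<bar>\<alpha>\<bar> * norm (?M *v v x) + \<bar>\<beta>\<bar> * norm (?M *v J (v x))"
      by (rule norm_triangle_le) simp
    also have "\<dots> \<le> norm z / norm (v x) * (Cv * pr n) + norm z / norm (v x) * (CJ * pr n)"
      using \<alpha> \<beta> v_up J_up by (intro add_mono mult_mono) auto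
    finally show "norm (?M *v z) \<le> C * pr n * norm z"
      by (simp add: C_def algebra_simps add_divide_distrib)
  qed
  have lower: "norm (v x) / norm f * pr n \<le> onorm (\<lambda>w. cocycle (rotA t) T n x *v w)" for n
  proof -
    have "norm (v x) * pr n \<le> onorm (\<lambda>w. cocycle (rotA t) T n x *v w) * norm f"
      using low[of n] onorm[OF matrix_vector_mul_bounded_linear, of "cocycle (rotA t) T n x" f] by linarith
    then show ?thesis using nz by (simp add: field_simps)
  qed
  show ?thesis
    using upper lower Cp nz v_nz[of x] unfolding pr_def
    by (intro exI[of _ "norm (v x) / norm f"] exI[of _ C]) auto
qed

text \<open>The first integral does not depend on the angle, so analyticity and concavity concern
  only the integral of ln \<open>den\<close>.\<close>

lemma upper_lyapunov_rotA:
  assumes "prob_space M" and sM: "sets M = sets borel" and TM: "T \<in> measurable M M"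
    and inv: "distr M M T = M" and erg: "ergodic M T" and t: "\<bar>t\<bar> < r0"
  shows "upper_lyapunov M T (rotA t) = (\<integral>x. ln (growth x) \<partial>M) + (\<integral>x. ln (den x t (s t x)) \<partial>M)"
proof -
  interpret prob_space M by fact
  define g where "g x = ln (growth x) + ln (den x t (s t x))" for x
  have gz: "growth x \<noteq> 0" "den x t (s t x) \<noteq> 0" for x
    using growth_pos[of x] den_s_pos[OF t, of x] by auto
  have c1: "continuous_on UNIV (\<lambda>x. ln (growth x))"
    using cont_growth gz by (intro continuous_on_ln) (auto simp: growth_def)
  have c2: "continuous_on UNIV (\<lambda>x. ln (den x t (s t x)))"
    using gz by (intro continuous_on_ln continuous_den_s t) auto
  have cg: "continuous_on UNIV g" unfolding g_def by (intro continuous_on_add c1 c2)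
  obtain B where B: "\<And>x. \<bar>g x\<bar> \<le> B"
    using compact_imp_bounded[OF compact_continuous_image[OF cg cpt]] by (auto simp: bounded_iff)
  have gm: "g \<in> borel_measurable M"
    using borel_measurable_continuous_onI[OF cg] measurable_cong_sets[OF sM refl] by blast
  have "AE x in M. (\<lambda>n. (\<Sum>i<n. g ((T ^^ i) x)) / real n) \<longlonglongrightarrow> (\<integral>x. g x \<partial>M)"
    by (rule birkhoff_ergodic_bounded[OF assms(1) TM inv erg gm B])
  then have "AE x in M. (\<lambda>n. ln (onorm (\<lambda>w. cocycle (rotA t) T n x *v w)) / real n) \<longlonglongrightarrow> (\<integral>x. g x \<partial>M)"
  proof eventually_elim
    fix x assume lim: "(\<lambda>n. (\<Sum>i<n. g ((T ^^ i) x)) / real n) \<longlonglongrightarrow> (\<integral>x. g x \<partial>M)"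
    define pr where "pr n = (\<Prod>i<n. growth ((T ^^ i) x) * den ((T ^^ i) x) t (s t ((T ^^ i) x)))" for n
    have pr: "0 < pr n" for n
      unfolding pr_def using growth_pos den_s_pos[OF t] by (intro prod_pos) auto
    have ln_pr: "ln (pr n) = (\<Sum>i<n. g ((T ^^ i) x))" for n
    proof -
      have "ln (pr n) = (\<Sum>i<n. ln (growth ((T ^^ i) x) * den ((T ^^ i) x) t (s t ((T ^^ i) x))))"
        unfolding pr_def using gz growth_pos den_s_pos[OF t] by (intro ln_prod) auto
      then show ?thesis using growth_pos den_s_pos[OF t] by (simp add: g_def ln_mult_pos)
    qed
    obtain c C where cC: "0 < c" "0 < C" "\<And>n. c * pr n \<le> onorm (\<lambda>w. cocycle (rotA t) T n x *v w)"
      "\<And>n. onorm (\<lambda>w. cocycle (rotA t) T n x *v w) \<le> C * pr n"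
      using onorm_cocycle_bounds[OF t, of x] unfolding pr_def by blast
    have lims: "(\<lambda>n. (ln k + (\<Sum>i<n. g ((T ^^ i) x))) / real n) \<longlonglongrightarrow> (\<integral>x. g x \<partial>M)" for k
      using tendsto_add[OF lim_const_over_n[of "ln k"] lim] by (simp add: add_divide_distrib)
    show "(\<lambda>n. ln (onorm (\<lambda>w. cocycle (rotA t) T n x *v w)) / real n) \<longlonglongrightarrow> (\<integral>x. g x \<partial>M)"
    \<comment> \<open>The multiplicative constants become ln c / n and ln C / n, which tend to
      0.\<close>
    proof (rule tendsto_sandwich[OF always_eventually always_eventually lims[of c] lims[of C]]; intro allI)
      fix n
      have pos: "0 < c * pr n" "0 < C * pr n" using cC pr by simp_all
      have "ln (c * pr n) \<le> ln (onorm (\<lambda>w. cocycle (rotA t) T n x *v w))"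
        using cC(3)[of n] pos by (subst ln_le_cancel_iff) auto
      then show "(ln c + (\<Sum>i<n. g ((T ^^ i) x))) / real n \<le> ln (onorm (\<lambda>w. cocycle (rotA t) T n x *v w)) / real n"
        using cC(1) pr[of n] by (intro divide_right_mono) (auto simp: ln_mult_pos ln_pr)
      have "ln (onorm (\<lambda>w. cocycle (rotA t) T n x *v w)) \<le> ln (C * pr n)"
        using cC(3,4)[of n] pos by (subst ln_le_cancel_iff) auto
      then show "ln (onorm (\<lambda>w. cocycle (rotA t) T n x *v w)) / real n \<le> (ln C + (\<Sum>i<n. g ((T ^^ i) x))) / real n"
        using cC(2) pr[of n] by (intro divide_right_mono) (auto simp: ln_mult_pos ln_pr)
    qed
  qed
  then have "upper_lyapunov M T (rotA t) = (\<integral>x. g x \<partial>M)" by (rule upper_lyapunov_eqI[OF assms(1)])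
  also have "\<dots> = (\<integral>x. ln (growth x) \<partial>M) + (\<integral>x. ln (den x t (s t x)) \<partial>M)"
    unfolding g_def by (intro Bochner_Integration.integral_add integrable_continuous_compact[OF cpt assms(1) sM] c1 c2)
  finally show ?thesis .
qed

end

theorem theoremA:
  fixes T :: "'a::metric_space \<Rightarrow> 'a" and \<mu> :: "'a measure" and A :: "'a \<Rightarrow> real^2^2"
  assumes "compact (UNIV :: 'a set)"
    and "homeomorphism UNIV UNIV T (inv T)"
    and "sets \<mu> = sets borel"
    and "prob_space \<mu>"
    and "T \<in> measurable \<mu> \<mu>" and "distr \<mu> \<mu> T = \<mu>"
    and "ergodic \<mu> T"
    and "continuous_on UNIV A"
    and "\<forall>x. det (A x) > 0"
    and "dominated_splitting T A"
  shows "\<exists>U::real set. open U \<and> U \<noteq> {} \<and>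
           (\<forall>\<theta>\<in>U. dominated_splitting T (\<lambda>x. A x ** rot \<theta>)) \<and>
           real_analytic_on U (\<lambda>\<theta>. upper_lyapunov \<mu> T (\<lambda>x. A x ** rot \<theta>)) \<and>
           strictly_concave_on U (\<lambda>\<theta>. upper_lyapunov \<mu> T (\<lambda>x. A x ** rot \<theta>))"
proof -
  have hom: "continuous_on UNIV T" "continuous_on UNIV (inv T)" "inv T (T x) = x" "T (inv T x) = x" for x
    using assms(2) by (auto simp: homeomorphism_def)
  have det: "0 < det (A x)" for x using assms(9) by blast
  obtain v b d W q where v: "continuous_line_field (\<lambda>x. span {v x})" "\<And>x. v x \<noteq> 0"
    "\<And>x. \<exists>k. A x *v v x = k *\<^sub>R v (T x)"
    "\<And>x. A x *v J (v x) = b x *\<^sub>R (A x *v v x) + d x *\<^sub>R J (A x *v v x)"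
    "continuous_on UNIV (\<lambda>x. norm (A x *v v x) / norm (v x))"
    and c: "continuous_on UNIV b" "continuous_on UNIV d" "continuous_on UNIV W"
    "\<And>x. 0 < d x" "\<And>x. 0 < W x" "0 < q" "q < (1::real)" "\<And>x. d x * W (T x) \<le> q * W x"
    using dominated_splitting_triangular[OF assms(1) hom(1,3) assms(8) det assms(10)] by blast
  obtain \<rho> \<epsilon> R r r0 where "triangular_cocycle T (inv T) b d W \<rho> \<epsilon> R r r0"
    using triangular_cocycle_exists[OF assms(1) hom(4,3) hom(1,2) c] by blast
  then interpret rotated_cocycle T b d W \<rho> \<epsilon> R r r0 A v
    using det v by (intro rotated_cocycle.intro rotated_cocycle_axioms.intro)
  note L = upper_lyapunov_rotA[OF assms(4,3,5,6,7)]
  show ?thesis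
  \<comment> \<open>An interval is needed, since \<open>strictly_concave_on\<close> includes
    convexity of the domain.\<close>
  proof (intro exI[of _ "{-r0<..<r0}"] conjI ballI)
    show "{-r0<..<r0} \<noteq> {}" using r0_pos by simp
    show "dominated_splitting T (rotA \<theta>)" if "\<theta> \<in> {-r0<..<r0}" for \<theta>
      using that by (intro dominated_splitting_rotA) auto
    show "real_analytic_on {-r0<..<r0} (\<lambda>\<theta>. upper_lyapunov \<mu> T (rotA \<theta>))"
      by (rule real_analytic_exponent[OF assms(4,3) L])
    show "strictly_concave_on {-r0<..<r0} (\<lambda>\<theta>. upper_lyapunov \<mu> T (rotA \<theta>))"
      by (rule strictly_concave_exponent[OF assms(4,3,5,6) L])
  qed simp
qed

end
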